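(* Let $X$ and $Y$ be Tychonoff spaces and let $T:C_p(X)\to C_p(Y)$ be a linear continuous surjection. If $\dim X=0$, then $\dim Y=0$.
   Context: All spaces are (non-empty) Tychonoff spaces. $C_p(X)$ is the set of all continuous real-valued functions on $X$ endowed with the topology of pointwise convergence. $\dim$ is the covering dimension defined by finite functionally open covers: $\dim X\le n$ if every finite cover of $X$ by functionally open sets (cozero sets) has a finite functionally open refinement such that each point lies in at most $n+1$ of its members. *)

theory Defs
  imports "HOL-Analysis.Analysis" "HOL-Library.Extended_Nat"
begin

definition Tychonoff_space :: "'a topology \<Rightarrow> bool" where
  "Tychonoff_space X \<longleftrightarrow> completely_regular_space X \<and> Hausdorff_space X"

text \<open>
  A real function on \<open>topspace X\<close> is represented by its extensional version (with value
  \<open>undefined\<close> outside \<open>topspace X\<close>), as in the carrier of \<^const>\<open>product_topology\<close>;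
  the product topology is the topology of pointwise convergence.
\<close>

definition Cp :: "'a topology \<Rightarrow> ('a \<Rightarrow> real) topology" where
  "Cp X = subtopology (product_topology (\<lambda>_. euclideanreal) (topspace X))
            {f. continuous_map X euclideanreal f}"

lemma topspace_Cp:
  "topspace (Cp X) = {f \<in> extensional (topspace X). continuous_map X euclideanreal f}"
  by (auto simp: Cp_def PiE_def)

text \<open>
  The restrictions make the pointwise sum and scalar multiple extensional again.
\<close>

definition Cp_linear :: "'a topology \<Rightarrow> 'b topology \<Rightarrow> (('a \<Rightarrow> real) \<Rightarrow> ('b \<Rightarrow> real)) \<Rightarrow> bool" where
  "Cp_linear X Y T \<longleftrightarrow>
     (\<forall>f\<in>topspace (Cp X). \<forall>g\<in>topspace (Cp X).
        T (\<lambda>x\<in>topspace X. f x + g x) = (\<lambda>y\<in>topspace Y. T f y + T g y)) \<and>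
     (\<forall>c. \<forall>f\<in>topspace (Cp X).
        T (\<lambda>x\<in>topspace X. c * f x) = (\<lambda>y\<in>topspace Y. c * T f y))"

definition functionally_open :: "'a topology \<Rightarrow> 'a set \<Rightarrow> bool" where
  "functionally_open X U \<longleftrightarrow>
     (\<exists>f. continuous_map X euclideanreal f \<and> U = {x \<in> topspace X. f x \<noteq> 0})"

definition finite_functionally_open_cover :: "'a topology \<Rightarrow> 'a set set \<Rightarrow> bool" where
  "finite_functionally_open_cover X \<U> \<longleftrightarrow>
     finite \<U> \<and> (\<forall>U\<in>\<U>. functionally_open X U) \<and> \<Union>\<U> = topspace X"

definition covering_dim_le :: "'a topology \<Rightarrow> nat \<Rightarrow> bool" where
  "covering_dim_le X n \<longleftrightarrow>
     (\<forall>\<U>. finite_functionally_open_cover X \<U> \<longrightarrow>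
        (\<exists>\<V>. finite_functionally_open_cover X \<V> \<and>
             (\<forall>V\<in>\<V>. \<exists>U\<in>\<U>. V \<subseteq> U) \<and>
             (\<forall>x\<in>topspace X. card {V \<in> \<V>. x \<in> V} \<le> n + 1)))"

text \<open>
  The infimum of the empty set in \<^typ>\<open>enat\<close> is \<open>\<infinity>\<close>. The definition is meant for non-empty
  spaces: the empty space gets dimension \<open>0\<close> here rather than the conventional \<open>-1\<close>.
\<close>

definition covering_dim :: "'a topology \<Rightarrow> enat" where
  "covering_dim X = Inf {enat n | n. covering_dim_le X n}"

end

theory Submission
  imports Defs
begin

text \<open>
  For \<open>y \<in> Y\<close> the functional sending \<open>f\<close> to \<open>T f y\<close> is continuous for pointwise convergence, hence a
  combination of finitely many point evaluations
  (\<open>continuous_functional_finite_support\<close>): it is given by finitely many atoms in \<open>X\<close> with nonzero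
  weights. Surjectivity says that every continuous function \<open>g\<close> on \<open>Y\<close> arises by applying these
  functionals to some \<open>f\<close>. The atoms live in the zero-dimensional space \<open>X\<close>, but the weights are real
  numbers, and the point of the proof is that they cannot create dimension.

  The reason is an algebraic one. Consider points \<open>y\<close> whose functional has \<open>n\<close> atoms
  \<open>x\<^sub>1, ..., x\<^sub>n\<close> with weights \<open>m\<^sub>1, ..., m\<^sub>n\<close>. Surjectivity provides functions
  \<open>f\<^sub>0, ..., f\<^sub>n\<close> on \<open>X\<close> that are mapped to the powers \<open>1, g, ..., g ^ n\<close>, so \<open>g y ^ k\<close> is the sum of the
  \<open>m\<^sub>i * f\<^sub>k x\<^sub>i\<close> over \<open>i\<close>. The \<open>n + 1\<close> vectors of values of the \<open>f\<^sub>k\<close> at the \<open>n\<close> atoms are linearly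
  dependent, so \<open>g y\<close> is a root of a nonzero polynomial that depends on the atoms only. Near a given
  point, with bounded weights, the same polynomial is still almost zero at \<open>g\<close> as long as the atoms move
  little (\<open>coordinate_almost_algebraic\<close>), and the atoms can be confined by clopen conditions. Hence on a
  suitable clopen set \<open>g\<close> omits values on both sides of its value at the given point, and one can cut
  there (\<open>coordinate_clopen_oscillation\<close>).

  It follows that the set of points with a fixed pattern of atoms and bounded weights has a base of clopen
  sets. To conclude that \<open>Y\<close> itself has clopen separation, one needs countably many closed pieces, the
  Lindelof property and the countable sum theorem (\<open>countable_closed_sum_ultranormal\<close>). These become
  available after a Lowenheim-Skolem argument: a countable family of continuous functions on \<open>X\<close>, closed
  under the operations used above (\<open>separable_reduction_exists\<close>), maps \<open>Y\<close> onto a subspace of the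
  space of real sequences, where the pieces are the sets \<open>stratum \<U> M\<close>. A clopen set that separates in
  this image is pulled back to \<open>Y\<close>. Clopen separation for all continuous functions is equivalent
  to covering dimension zero.
\<close>

section \<open>Large inductive dimension zero and the countable sum theorem\<close>

text \<open>
  This is large inductive dimension at most zero. It is the form of zero-dimensionality that passes
  to countable closed unions; the small inductive version \<open>X dim_le 0\<close>, which is the one that can be
  checked locally, is linked to it by the Lindelof property.
\<close>

definition ultranormal_space :: "'a topology \<Rightarrow> bool" where
  "ultranormal_space X \<longleftrightarrow>
     (\<forall>A B. closedin X A \<and> closedin X B \<and> A \<inter> B = {} \<longrightarrow>
        (\<exists>H. openin X H \<and> closedin X H \<and> A \<subseteq> H \<and> B \<inter> H = {}))"

lemma ultranormal_spaceE:
  assumes "ultranormal_space X" "closedin X A" "closedin X B" "A \<inter> B = {}"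
  obtains H where "openin X H" "closedin X H" "A \<subseteq> H" "B \<inter> H = {}"
  using assms unfolding ultranormal_space_def by metis

text \<open>
  Each point has a clopen neighbourhood that misses \<open>A\<close> or \<open>B\<close>. Countably many of these cover the
  space and can be made disjoint without losing clopenness; the union of those that miss \<open>B\<close> is then
  open, and so is its complement.
\<close>

lemma Lindelof_dim_le_0_imp_ultranormal_space:
  assumes "Lindelof_space X" "X dim_le 0"
  shows "ultranormal_space X"
  unfolding ultranormal_space_def
proof (intro allI impI; elim conjE)
  fix A B assume A: "closedin X A" and B: "closedin X B" and AB: "A \<inter> B = {}"
  let ?\<V> = "{V. openin X V \<and> closedin X V \<and> (A \<inter> V = {} \<or> B \<inter> V = {})}"
  have base: "\<exists>V. openin X V \<and> closedin X V \<and> x \<in> V \<and> V \<subseteq> W" if W: "openin X W" "x \<in> W" for x W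
  proof -
    have "neighbourhood_base_of (\<lambda>U. closedin X U \<and> openin X U) X"
      using assms(2) by (simp add: dimension_le_0_neighbourhood_base_of_clopen)
    then obtain U V where "openin X U" "closedin X V" "openin X V" "x \<in> U" "U \<subseteq> V" "V \<subseteq> W"
      using W unfolding neighbourhood_base_of by metis
    then show ?thesis by blast
  qed
  have "\<Union>?\<V> = topspace X"
  proof
    show "\<Union>?\<V> \<subseteq> topspace X" using openin_subset by blast
    show "topspace X \<subseteq> \<Union>?\<V>"
    proof
      fix x assume x: "x \<in> topspace X"
      show "x \<in> \<Union>?\<V>"
      proof (cases "x \<in> A")
        case True
        then have "x \<in> topspace X - B" using AB x by blast
        then show ?thesis using base[of "topspace X - B" x] B by blast
      next
        case False
        then have "x \<in> topspace X - A" using x by blast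
        then show ?thesis using base[of "topspace X - A" x] A by blast
      qed
    qed
  qed
  then have "\<exists>\<V>. countable \<V> \<and> \<V> \<subseteq> ?\<V> \<and> \<Union>\<V> = topspace X"
    by (intro Lindelof_spaceD[OF assms(1)]) simp_all
  then obtain \<V> where \<V>: "countable \<V>" "\<V> \<subseteq> ?\<V>" "\<Union>\<V> = topspace X" by (elim exE conjE)
  show "\<exists>H. openin X H \<and> closedin X H \<and> A \<subseteq> H \<and> B \<inter> H = {}"
  proof (cases "\<V> = {}")
    case True
    then have "topspace X = {}" using \<V> by auto
    then show ?thesis using A B closedin_subset by (intro exI[of _ "{}"]) auto
  next
    case False
    define v where "v = from_nat_into \<V>"
    have rv: "range v = \<V>" unfolding v_def using \<V>(1) False by simp
    have vV: "openin X (v i)" "closedin X (v i)" "A \<inter> v i = {} \<or> B \<inter> v i = {}" for i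
      using \<V>(2) rv by blast+
    define w where "w i = v i - (\<Union>j<i. v j)" for i
    have wopen: "openin X (w i)" for i
      unfolding w_def by (intro openin_diff closedin_Union) (auto simp: vV)
    have wdisj: "w i \<inter> w j = {}" if "i \<noteq> j" for i j
      using that unfolding w_def by (cases i j rule: linorder_cases) auto
    have wcov: "(\<Union>i. w i) = topspace X"
    proof -
      have "(\<Union>i. w i) = (\<Union>i. v i)"
        using UN_disjointed_eq[of v] unfolding w_def disjointed_def atLeast0LessThan .
      then show ?thesis using \<V>(3) rv by simp
    qed
    define H where "H = (\<Union>i\<in>{i. B \<inter> v i = {}}. w i)"
    define K where "K = (\<Union>i\<in>{i. B \<inter> v i \<noteq> {}}. w i)"
    have "openin X H" "openin X K" unfolding H_def K_def by (auto intro: wopen)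
    moreover have "H \<union> K = topspace X" unfolding H_def K_def using wcov by blast
    moreover have "H \<inter> K = {}"
    proof (rule equals0I)
      fix x assume "x \<in> H \<inter> K"
      then obtain i j where "x \<in> w i" "B \<inter> v i = {}" "x \<in> w j" "B \<inter> v j \<noteq> {}"
        unfolding H_def K_def by auto
      then show False using wdisj[of i j] by auto
    qed
    ultimately have "topspace X - H = K" by auto
    then have "closedin X H" using \<open>openin X K\<close> \<open>openin X H\<close>
      by (simp add: closedin_def openin_subset)
    moreover have "B \<inter> H = {}" unfolding H_def w_def by auto
    moreover have "A \<inter> K = {}"
    proof (rule equals0I)
      fix x assume "x \<in> A \<inter> K"
      then obtain i where "x \<in> A" "x \<in> v i" "B \<inter> v i \<noteq> {}" unfolding K_def w_def by auto
      then show False using vV(3)[of i] by auto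
    qed
    then have "A \<subseteq> H" using \<open>H \<union> K = topspace X\<close> closedin_subset[OF A] by auto
    ultimately show ?thesis using \<open>openin X H\<close> by auto
  qed
qed

text \<open>
  The separation is extended over one piece at a time. A partial separation is recorded as a
  real function \<open>u n\<close>: the set \<open>{u n \<le> 1/3}\<close> has been assigned to \<open>A\<close> and the set \<open>{u n \<ge> 2/3}\<close> to
  \<open>B\<close>. On the next piece \<open>C n\<close> these two disjoint closed sets are separated by a relatively clopen
  set, so a Urysohn function \<open>u (Suc n)\<close> can keep the former decisions and take only the values 0 and
  1 on \<open>C n\<close>. The slack between 0 and 1/3 is what makes the final union of all decisions open.
\<close>

lemma countable_closed_sum_ultranormal:
  assumes normal: "normal_space X"
    and closed: "\<And>n. closedin X (C n)" and cover: "topspace X = (\<Union>n::nat. C n)"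
    and piece: "\<And>n. ultranormal_space (subtopology X (C n))"
  shows "ultranormal_space X"
  unfolding ultranormal_space_def
proof (intro allI impI; elim conjE)
  fix A B assume A: "closedin X A" and B: "closedin X B" and AB: "A \<inter> B = {}"
  let ?P = "\<lambda>(n::nat) u. continuous_map X euclideanreal u \<and> A \<subseteq> {x. u x = 0} \<and> B \<subseteq> {x. u x = 1}"
  let ?Q = "\<lambda>n u u'. (\<forall>x\<in>topspace X. (u x \<le> 1/3 \<longrightarrow> u' x = 0) \<and> (u x \<ge> 2/3 \<longrightarrow> u' x = 1)) \<and>
              C n \<subseteq> {x. u' x = 0 \<or> u' x = 1}"
  have ury: "\<exists>u. continuous_map X euclideanreal u \<and> P \<subseteq> {x. u x = 0} \<and> Q \<subseteq> {x. u x = 1}"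
    if PQ: "closedin X P" "closedin X Q" "P \<inter> Q = {}" for P Q
    proof -
    obtain u where "continuous_map X euclideanreal u" "u ` P \<subseteq> {0}" "u ` Q \<subseteq> {1}"
      using Urysohn_lemma_alt[OF normal PQ(1,2), of 0 1] PQ(3) by (auto simp: disjnt_def)
    then show ?thesis by blast
  qed
  have "\<exists>u. \<forall>n. ?P n (u n) \<and> ?Q n (u n) (u (Suc n))"
  proof (rule dependent_nat_choice)
    show "\<exists>u. ?P 0 u" using ury[OF A B AB] by blast
  next
    fix u n assume u: "?P n u"
    define P where "P = {x \<in> topspace X. u x \<le> 1/3}"
    define Q where "Q = {x \<in> topspace X. u x \<ge> 2/3}"
    have P: "closedin X P"
      using closedin_continuous_map_preimage[of X euclideanreal u "{..1/3}"] u
      by (simp add: P_def)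
    have Q: "closedin X Q"
      using closedin_continuous_map_preimage[of X euclideanreal u "{2/3..}"] u
      by (simp add: Q_def)
    have PQ: "P \<inter> Q = {}" unfolding P_def Q_def by auto
    obtain H where H: "openin (subtopology X (C n)) H" "closedin (subtopology X (C n)) H"
        "C n \<inter> P \<subseteq> H" "C n \<inter> Q \<inter> H = {}"
    proof (rule ultranormal_spaceE[OF piece])
      show "closedin (subtopology X (C n)) (C n \<inter> P)" "closedin (subtopology X (C n)) (C n \<inter> Q)"
        using P Q by (auto intro: closedin_subtopology_Int_closed)
    qed (use PQ in auto)
    have sub: "H \<subseteq> C n" "C n \<subseteq> topspace X"
      using openin_subset[OF H(1)] closedin_subset[OF closed] by auto
    have "closedin (subtopology X (C n)) (C n - H)"
      using H(1) sub by (simp add: closedin_diff closedin_subtopology_refl)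
    then have "closedin X H" "closedin X (C n - H)"
      using H(2) closed closedin_trans_full by blast+
    then have "closedin X (P \<union> H)" "closedin X (Q \<union> (C n - H))" using P Q by blast+
    moreover have "(P \<union> H) \<inter> (Q \<union> (C n - H)) = {}" using H sub PQ by blast
    ultimately obtain u' where u': "continuous_map X euclideanreal u'"
        "P \<union> H \<subseteq> {x. u' x = 0}" "Q \<union> (C n - H) \<subseteq> {x. u' x = 1}"
      using ury[of "P \<union> H" "Q \<union> (C n - H)"] by auto
    have "A \<subseteq> P" "B \<subseteq> Q"
      using u closedin_subset[OF A] closedin_subset[OF B] unfolding P_def Q_def by auto
    then have "?P (Suc n) u'" using u' by blast
    moreover have "?Q n u u'" using u' unfolding P_def Q_def by blast
    ultimately show "\<exists>u'. ?P (Suc n) u' \<and> ?Q n u u'" by blast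
  qed
  then obtain u where cont: "\<And>n. continuous_map X euclideanreal (u n)"
    and uA: "\<And>n x. x \<in> A \<Longrightarrow> u n x = 0" and uB: "\<And>n x. x \<in> B \<Longrightarrow> u n x = 1"
    and low: "\<And>n x. \<lbrakk>x \<in> topspace X; u n x \<le> 1/3\<rbrakk> \<Longrightarrow> u (Suc n) x = 0"
    and high: "\<And>n x. \<lbrakk>x \<in> topspace X; u n x \<ge> 2/3\<rbrakk> \<Longrightarrow> u (Suc n) x = 1"
    and dec: "\<And>n x. x \<in> C n \<Longrightarrow> u (Suc n) x = 0 \<or> u (Suc n) x = 1"
    by (fastforce simp: subset_eq)
  define H where "H = (\<Union>n. {x \<in> topspace X. u n x < 1/3})"
  define K where "K = (\<Union>n. {x \<in> topspace X. u n x > 2/3})"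
  have "openin X {x \<in> topspace X. u n x < 1/3}" "openin X {x \<in> topspace X. u n x > 2/3}" for n
    using openin_continuous_map_preimage[OF cont[of n], of "{..<1/3}"]
      openin_continuous_map_preimage[OF cont[of n], of "{2/3<..}"] by simp_all
  then have "openin X H" "openin X K" unfolding H_def K_def by auto
  have stay_low: "u m x = 0" if "x \<in> topspace X" "u n x < 1/3" "n < m" for n m x
    using \<open>n < m\<close>
  proof (induction m)
    case (Suc m)
    then have "u m x \<le> 1/3" using that by (cases "n = m") auto
    then show ?case using low that by blast
  qed simp
  have stay_high: "u m x = 1" if "x \<in> topspace X" "u n x > 2/3" "n < m" for n m x
    using \<open>n < m\<close>
  proof (induction m)
    case (Suc m)
    then have "u m x \<ge> 2/3" using that by (cases "n = m") auto
    then show ?case using high that by blast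
  qed simp
  have "H \<inter> K = {}"
  proof (rule ccontr)
    assume "H \<inter> K \<noteq> {}"
    then obtain x n m where "x \<in> topspace X" "u n x < 1/3" "u m x > 2/3"
      unfolding H_def K_def by blast
    then show False
      using stay_low[of x n "Suc (n + m)"] stay_high[of x m "Suc (n + m)"] by simp
  qed
  moreover have "H \<union> K = topspace X"
  proof -
    have "x \<in> H \<union> K" if "x \<in> C n" for x n
    proof -
      have "x \<in> topspace X" using that cover by blast
      moreover have "u (Suc n) x < 1/3 \<or> u (Suc n) x > 2/3" using dec[OF that] by auto
      ultimately show ?thesis unfolding H_def K_def by blast
    qed
    then have "topspace X \<subseteq> H \<union> K" unfolding cover by (rule UN_least[OF subsetI])
    moreover have "H \<subseteq> topspace X" "K \<subseteq> topspace X"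
      using \<open>openin X H\<close> \<open>openin X K\<close> openin_subset by blast+
    ultimately show ?thesis by (intro equalityI Un_least)
  qed
  ultimately have "topspace X - H = K" by blast
  then have "closedin X H" using \<open>openin X K\<close> \<open>openin X H\<close> by (simp add: closedin_def openin_subset)
  moreover have "A \<subseteq> H"
    using uA closedin_subset[OF A] unfolding H_def by fastforce
  moreover have "B \<subseteq> K"
    using uB closedin_subset[OF B] unfolding K_def by fastforce
  ultimately show "\<exists>H. openin X H \<and> closedin X H \<and> A \<subseteq> H \<and> B \<inter> H = {}"
    using \<open>openin X H\<close> \<open>H \<inter> K = {}\<close> by blast
qed

section \<open>Linear dependence and countable closure\<close>

text \<open>
  More vectors than coordinates are linearly dependent. The proof is Gaussian elimination: if some
  vector \<open>a p\<close> has a nonzero \<open>j\<close>-coordinate, that coordinate is cleared from the others, and \<open>s\<close>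
  enumerates the indices different from the pivot \<open>p\<close>.
\<close>

lemma exists_nontrivial_dependency:
  fixes a :: "nat \<Rightarrow> 'i \<Rightarrow> real"
  assumes "finite I"
  shows "\<exists>c. (\<exists>k\<le>card I. c k \<noteq> 0) \<and> (\<forall>i\<in>I. (\<Sum>k\<le>card I. c k * a k i) = 0)"
  using assms
proof (induction I arbitrary: a rule: finite_induct)
  case empty
  then show ?case by (auto intro!: exI[of _ "\<lambda>_. 1"])
next
  case (insert j I)
  have card: "card (insert j I) = Suc (card I)" using insert by simp
  show ?case
  proof (cases "\<forall>k\<le>Suc (card I). a k j = 0")
    case True
    obtain c where c: "\<exists>k\<le>card I. c k \<noteq> 0" "\<forall>i\<in>I. (\<Sum>k\<le>card I. c k * a k i) = 0"
      using insert.IH[of a] by blast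
    define c' where "c' k = (if k \<le> card I then c k else 0)" for k
    have "(\<Sum>k\<le>Suc (card I). c' k * a k i) = (\<Sum>k\<le>card I. c k * a k i)" for i
      by (simp add: c'_def)
    moreover have "\<exists>k\<le>Suc (card I). c' k \<noteq> 0" using c(1) unfolding c'_def by auto
    ultimately show ?thesis using c(2) True unfolding card
      by (intro exI[of _ c']) (auto intro!: sum.neutral simp del: sum.atMost_Suc)
  next
    case False
    then obtain p where p: "p \<le> Suc (card I)" "a p j \<noteq> 0" by blast
    define s where "s k = (if k < p then k else Suc k)" for k
    have inj: "inj_on s {..card I}" unfolding inj_on_def s_def by auto
    have img: "s ` {..card I} = {..Suc (card I)} - {p}"
    proof
      show "s ` {..card I} \<subseteq> {..Suc (card I)} - {p}" unfolding s_def by auto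
      show "{..Suc (card I)} - {p} \<subseteq> s ` {..card I}"
      proof
        fix k assume "k \<in> {..Suc (card I)} - {p}"
        then show "k \<in> s ` {..card I}" using p(1)
          unfolding s_def image_iff
          by (intro bexI[of _ "if k < p then k else k - 1"]) auto
      qed
    qed
    obtain c where c: "\<exists>k\<le>card I. c k \<noteq> 0"
        "\<forall>i\<in>I. (\<Sum>k\<le>card I. c k * (a (s k) i - a (s k) j / a p j * a p i)) = 0"
      using insert.IH[of "\<lambda>k i. a (s k) i - a (s k) j / a p j * a p i"] by blast
    define r where "r k = (if k < p then k else k - 1)" for k
    have rs: "r (s k) = k" for k unfolding r_def s_def by auto
    define c' where "c' k = (if k = p then - (\<Sum>k\<le>card I. c k * a (s k) j) / a p j else c (r k))" for k
    have sp: "s k \<noteq> p" for k unfolding s_def by auto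
    have split: "(\<Sum>k\<le>Suc (card I). c' k * a k i)
        = (\<Sum>k\<le>card I. c k * a (s k) i) - (\<Sum>k\<le>card I. c k * a (s k) j) / a p j * a p i" for i
    proof -
      have "(\<Sum>k\<le>Suc (card I). c' k * a k i) = c' p * a p i + (\<Sum>k\<in>{..Suc (card I)} - {p}. c' k * a k i)"
        using p(1) by (intro sum.remove) auto
      also have "(\<Sum>k\<in>{..Suc (card I)} - {p}. c' k * a k i) = (\<Sum>k\<le>card I. c' (s k) * a (s k) i)"
        unfolding img[symmetric] using inj by (simp add: sum.reindex)
      also have "\<dots> = (\<Sum>k\<le>card I. c k * a (s k) i)"
        unfolding c'_def using sp rs by simp
      finally show ?thesis unfolding c'_def by simp
    qed
    have "(\<Sum>k\<le>Suc (card I). c' k * a k i) = 0" if "i \<in> I" for i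
    proof -
      have "0 = (\<Sum>k\<le>card I. c k * (a (s k) i - a (s k) j / a p j * a p i))" using c(2) that by simp
      also have "\<dots> = (\<Sum>k\<le>card I. c k * a (s k) i) - (\<Sum>k\<le>card I. c k * a (s k) j) / a p j * a p i"
        by (simp add: sum_subtractf sum_distrib_right sum_distrib_left sum_divide_distrib algebra_simps)
      finally show ?thesis using split by simp
    qed
    moreover have "(\<Sum>k\<le>Suc (card I). c' k * a k j) = 0" unfolding split using p(2) by simp
    moreover obtain k where "k \<le> card I" "c k \<noteq> 0" using c(1) by blast
    then have "\<exists>k\<le>Suc (card I). c' k \<noteq> 0"
      using sp rs img by (intro exI[of _ "s k"]) (auto simp: c'_def s_def)
    ultimately show ?thesis unfolding card
      by (intro exI[of _ c']) (auto simp del: sum.atMost_Suc)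
  qed
qed

text \<open>
  A countable substructure containing given elements, as in the Lowenheim-Skolem argument. All
  operations are binary here; a unary one ignores its second argument.
\<close>

lemma countable_closure_exists:
  assumes "countable Ops" "countable B" "B \<subseteq> C"
    and "\<And>op f h. \<lbrakk>op \<in> Ops; f \<in> C; h \<in> C\<rbrakk> \<Longrightarrow> op f h \<in> C"
  shows "\<exists>F. countable F \<and> B \<subseteq> F \<and> F \<subseteq> C \<and> (\<forall>op\<in>Ops. \<forall>f\<in>F. \<forall>h\<in>F. op f h \<in> F)"
proof -
  define lev where "lev = rec_nat B (\<lambda>_ L. L \<union> (\<lambda>(op, f, h). op f h) ` (Ops \<times> L \<times> L))"
  have lev0: "lev 0 = B" and levS: "lev (Suc n) = lev n \<union> (\<lambda>(op, f, h). op f h) ` (Ops \<times> lev n \<times> lev n)" for n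
    by (simp_all add: lev_def)
  have "countable (lev n)" for n
    by (induction n) (auto simp: lev0 levS assms)
  then have "countable (\<Union>n. lev n)" by simp
  moreover have "lev n \<subseteq> C" for n
  proof (induction n)
    case 0
    then show ?case using assms(3) by (simp add: lev0)
  next
    case (Suc n)
    have "op f h \<in> C" if "op \<in> Ops" "f \<in> lev n" "h \<in> lev n" for op f h
      using assms(4)[OF that(1)] that(2,3) Suc by blast
    then show ?case using Suc by (auto simp: levS)
  qed
  moreover have "op f h \<in> (\<Union>n. lev n)" if ops: "op \<in> Ops" "f \<in> (\<Union>n. lev n)" "h \<in> (\<Union>n. lev n)" for op f h
  proof -
    have mono: "lev n \<subseteq> lev m" if "n \<le> m" for n m
      using that by (rule lift_Suc_mono_le[rotated]) (simp add: levS)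
    obtain n m where "f \<in> lev n" "h \<in> lev m" using ops by blast
    then have "f \<in> lev (max n m)" "h \<in> lev (max n m)" using mono by (meson max.cobounded1 max.cobounded2 subsetD)+
    then have "op f h \<in> lev (Suc (max n m))" using ops(1) by (auto simp: levS image_iff intro!: bexI[of _ "(op, f, h)"])
    then show ?thesis by blast
  qed
  moreover have "B \<subseteq> (\<Union>n. lev n)" using lev0 by blast
  ultimately show ?thesis
    by (intro exI[of _ "\<Union>n. lev n"] conjI ballI UN_least)
qed

section \<open>Finitely supported functionals\<close>

text \<open>
  The abstract situation of a linear continuous surjection \<open>T\<close>: here \<open>L y f\<close> is \<open>T f y\<close>. Continuity of
  \<open>T\<close> enters through the finite support of each functional \<open>L y\<close>, and zero-dimensionality of \<open>X\<close>
  through clopen sets, given by their continuous indicator functions. Neither \<open>f\<close> nor a clopen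
  set is confined to \<open>topspace X\<close>, so that products and complements are the plain ones.
\<close>

locale finitely_supported_surjection =
  fixes X :: "'a topology" and Y :: "'b topology"
    and L :: "'b \<Rightarrow> ('a \<Rightarrow> real) \<Rightarrow> real"
  assumes zero_dim: "\<lbrakk>continuous_map X euclideanreal f; a < b\<rbrakk> \<Longrightarrow>
      \<exists>U. continuous_map X euclideanreal (indicator U) \<and>
          (\<forall>x\<in>topspace X. (f x \<le> a \<longrightarrow> x \<in> U) \<and> (x \<in> U \<longrightarrow> f x < b))"
    and L_add: "\<lbrakk>y \<in> topspace Y; continuous_map X euclideanreal f; continuous_map X euclideanreal h\<rbrakk> \<Longrightarrow>
      L y (\<lambda>x. f x + h x) = L y f + L y h"
    and L_scale: "\<lbrakk>y \<in> topspace Y; continuous_map X euclideanreal f\<rbrakk> \<Longrightarrow>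
      L y (\<lambda>x. c * f x) = c * L y f"
    and L_finite_support: "y \<in> topspace Y \<Longrightarrow>
      \<exists>F. finite F \<and> F \<subseteq> topspace X \<and>
          (\<forall>f. continuous_map X euclideanreal f \<longrightarrow> (\<forall>x\<in>F. f x = 0) \<longrightarrow> L y f = 0)"
    and L_continuous: "continuous_map X euclideanreal f \<Longrightarrow> continuous_map Y euclideanreal (\<lambda>y. L y f)"
    and L_surjective: "continuous_map Y euclideanreal g \<Longrightarrow>
      \<exists>f. continuous_map X euclideanreal f \<and> (\<forall>y\<in>topspace Y. L y f = g y)"
begin

lemma L_zero: "y \<in> topspace Y \<Longrightarrow> L y (\<lambda>x. 0) = 0"
  using L_scale[of y "\<lambda>x. 0" 0] by simp

lemma L_sum:
  assumes "finite I" "y \<in> topspace Y" "\<And>i. i \<in> I \<Longrightarrow> continuous_map X euclideanreal (f i)"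
  shows "L y (\<lambda>x. \<Sum>i\<in>I. f i x) = (\<Sum>i\<in>I. L y (f i))"
  using assms
proof (induction I rule: finite_induct)
  case empty
  then show ?case by (simp add: L_zero)
next
  case (insert j I)
  then show ?case by (simp add: L_add continuous_map_sum)
qed

lemma L_diff:
  assumes "y \<in> topspace Y" "continuous_map X euclideanreal f" "continuous_map X euclideanreal h"
  shows "L y (\<lambda>x. f x - h x) = L y f - L y h"
proof -
  have "continuous_map X euclideanreal (\<lambda>x. -1 * h x)"
    using assms(3) by (intro continuous_intros) auto
  then show ?thesis
    using L_add[of y f "\<lambda>x. -1 * h x"] L_scale[of y h "-1"] assms by simp
qed

text \<open>
  A finitely supported functional looks like a sum of point masses to an algebra \<open>\<A>\<close> of clopen
  sets, even if \<open>\<A>\<close> does not separate the points of the support: finitely many members of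
  \<open>\<A>\<close> cut the support into its \<open>\<A>\<close>-indistinguishable classes, the atoms of these members
  each contain one class, and atoms of total weight zero are dropped.
\<close>

lemma L_atomic_representation:
  assumes y: "y \<in> topspace Y"
    and A_cont: "\<And>U. U \<in> \<A> \<Longrightarrow> continuous_map X euclideanreal (indicator U :: 'a \<Rightarrow> real)"
    and A_UNIV: "UNIV \<in> \<A>"
    and A_Int: "\<And>U V. \<lbrakk>U \<in> \<A>; V \<in> \<A>\<rbrakk> \<Longrightarrow> U \<inter> V \<in> \<A>"
    and A_Compl: "\<And>U. U \<in> \<A> \<Longrightarrow> - U \<in> \<A>"
  obtains \<U> p where "finite \<U>" "\<U> \<subseteq> \<A>" "disjoint \<U>"
    "\<forall>U\<in>\<U>. p U \<in> topspace X \<inter> U" "\<forall>U\<in>\<U>. L y (indicator U) \<noteq> 0"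
    "\<forall>f. continuous_map X euclideanreal f \<longrightarrow>
         (\<forall>x\<in>topspace X. \<forall>x'\<in>topspace X. (\<forall>V\<in>\<A>. x \<in> V \<longleftrightarrow> x' \<in> V) \<longrightarrow> f x = f x') \<longrightarrow>
         L y f = (\<Sum>U\<in>\<U>. f (p U) * L y (indicator U))"
proof -
  obtain F where F: "finite F" "F \<subseteq> topspace X"
    and supp: "\<And>f. \<lbrakk>continuous_map X euclideanreal f; \<forall>x\<in>F. f x = 0\<rbrakk> \<Longrightarrow> L y f = 0"
    using L_finite_support[OF y] by blast
  define sep where "sep = (\<lambda>(x, x'). SOME B. B \<in> \<A> \<and> (x \<in> B \<longleftrightarrow> x' \<notin> B))"
  define \<B> where "\<B> = sep ` (F \<times> F) \<inter> \<A>"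
  have \<B>: "finite \<B>" "\<B> \<subseteq> \<A>" unfolding \<B>_def using F(1) by auto
  have \<B>_sep: "\<forall>V\<in>\<A>. x \<in> V \<longleftrightarrow> x' \<in> V"
    if "x \<in> F" "x' \<in> F" "\<forall>B\<in>\<B>. x \<in> B \<longleftrightarrow> x' \<in> B" for x x'
  proof (rule ccontr)
    assume "\<not> ?thesis"
    then have "\<exists>B. B \<in> \<A> \<and> (x \<in> B \<longleftrightarrow> x' \<notin> B)" by blast
    then have "sep (x, x') \<in> \<A> \<and> (x \<in> sep (x, x') \<longleftrightarrow> x' \<notin> sep (x, x'))"
      unfolding sep_def prod.case by (rule someI_ex)
    moreover from this have "sep (x, x') \<in> \<B>" unfolding \<B>_def using that by blast
    ultimately show False using that(3) by blast
  qed
  define atom where "atom x = {z. \<forall>B\<in>\<B>. z \<in> B \<longleftrightarrow> x \<in> B}" for x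
  have atom_A: "atom x \<in> \<A>" for x
  proof -
    have "{z. \<forall>B\<in>\<C>. z \<in> B \<longleftrightarrow> x \<in> B} \<in> \<A>" if "finite \<C>" "\<C> \<subseteq> \<A>" for \<C>
      using that
    proof (induction rule: finite_induct)
      case empty
      then show ?case using A_UNIV by simp
    next
      case (insert B \<C>)
      have "{z. \<forall>B\<in>insert B \<C>. z \<in> B \<longleftrightarrow> x \<in> B}
          = (if x \<in> B then B else - B) \<inter> {z. \<forall>B\<in>\<C>. z \<in> B \<longleftrightarrow> x \<in> B}" by auto
      moreover have "(if x \<in> B then B else - B) \<in> \<A>" using insert.prems A_Compl by auto
      ultimately show ?case using insert A_Int by simp
    qed
    then show ?thesis unfolding atom_def using \<B> by blast
  qed
  define \<W> where "\<W> = atom ` F"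
  define p where "p W = (SOME x. x \<in> F \<and> atom x = W)" for W
  have p: "p W \<in> F" "atom (p W) = W" if "W \<in> \<W>" for W
  proof -
    have "\<exists>x. x \<in> F \<and> atom x = W" using that unfolding \<W>_def by blast
    then show "p W \<in> F" "atom (p W) = W" unfolding p_def by (metis (mono_tags, lifting) someI_ex)+
  qed
  have W_disj: "W = W'" if "W \<in> \<W>" "W' \<in> \<W>" "z \<in> W" "z \<in> W'" for W W' z
    using that unfolding \<W>_def atom_def by auto
  have finW: "finite \<W>" unfolding \<W>_def using F by blast
  define \<U> where "\<U> = {W \<in> \<W>. L y (indicator W) \<noteq> 0}"
  show ?thesis
  proof (rule that[of \<U> p])
    show "finite \<U>" "\<U> \<subseteq> \<A>" unfolding \<U>_def using finW atom_A \<W>_def by auto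
    show "disjoint \<U>" unfolding \<U>_def disjoint_def using W_disj by blast
    show "\<forall>U\<in>\<U>. p U \<in> topspace X \<inter> U"
    proof
      fix U assume "U \<in> \<U>"
      then have "U \<in> \<W>" using \<U>_def by blast
      then have "p U \<in> F" "atom (p U) = U" using p by blast+
      moreover have "p U \<in> atom (p U)" unfolding atom_def by simp
      ultimately show "p U \<in> topspace X \<inter> U" using F by auto
    qed
    show "\<forall>U\<in>\<U>. L y (indicator U) \<noteq> 0" using \<U>_def by blast
  next
    show "\<forall>f. continuous_map X euclideanreal f \<longrightarrow>
         (\<forall>x\<in>topspace X. \<forall>x'\<in>topspace X. (\<forall>V\<in>\<A>. x \<in> V \<longleftrightarrow> x' \<in> V) \<longrightarrow> f x = f x') \<longrightarrow>
         L y f = (\<Sum>U\<in>\<U>. f (p U) * L y (indicator U))"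
    proof (intro allI impI)
      fix f assume f: "continuous_map X euclideanreal f"
        and const: "\<forall>x\<in>topspace X. \<forall>x'\<in>topspace X. (\<forall>V\<in>\<A>. x \<in> V \<longleftrightarrow> x' \<in> V) \<longrightarrow> f x = f x'"
      \<comment> \<open>A combination of indicators of atoms that agrees with \<open>f\<close> on the whole support.\<close>
      define h where "h x = (\<Sum>W\<in>\<W>. f (p W) * indicator W x)" for x
      have Wcont: "continuous_map X euclideanreal (indicator W :: 'a \<Rightarrow> real)" if "W \<in> \<W>" for W
        using that A_cont atom_A \<W>_def by auto
      then have hc: "continuous_map X euclideanreal (\<lambda>x. f (p W) * indicator W x)" if "W \<in> \<W>" for W
        using that by (intro continuous_intros) auto
      then have h: "continuous_map X euclideanreal h"
        unfolding h_def using finW by (intro continuous_map_sum) auto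
      have "f x = h x" if x: "x \<in> F" for x
      proof -
        have "atom x \<in> \<W>" "x \<in> atom x" using x unfolding \<W>_def atom_def by auto
        then have "h x = (\<Sum>W\<in>{atom x}. f (p W) * indicator W x)"
          unfolding h_def using finW W_disj
          by (intro sum.mono_neutral_right) (auto simp: indicator_def)
        then have "h x = f (p (atom x))" using \<open>x \<in> atom x\<close> by simp
        have "\<forall>B\<in>\<B>. x \<in> B \<longleftrightarrow> p (atom x) \<in> B"
          using p(2)[OF \<open>atom x \<in> \<W>\<close>] unfolding atom_def by blast
        then have "\<forall>V\<in>\<A>. x \<in> V \<longleftrightarrow> p (atom x) \<in> V"
          by (rule \<B>_sep[OF x p(1)[OF \<open>atom x \<in> \<W>\<close>]])
        moreover have "x \<in> topspace X" "p (atom x) \<in> topspace X"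
          using F(2) x p(1)[OF \<open>atom x \<in> \<W>\<close>] by auto
        ultimately have "f x = f (p (atom x))" using const by metis
        then show ?thesis using \<open>h x = f (p (atom x))\<close> by simp
      qed
      then have "L y (\<lambda>x. f x - h x) = 0"
        using f h by (intro supp continuous_intros) auto
      then have "L y f = L y h" using L_diff[OF y f h] by simp
      also have "\<dots> = (\<Sum>W\<in>\<W>. L y (\<lambda>x. f (p W) * indicator W x))"
        unfolding h_def using L_sum[OF finW y, of "\<lambda>W x. f (p W) * indicator W x"] hc by blast
      also have "\<dots> = (\<Sum>W\<in>\<W>. f (p W) * L y (indicator W))"
        using L_scale[OF y] Wcont by (intro sum.cong refl) auto
      also have "\<dots> = (\<Sum>W\<in>\<U>. f (p W) * L y (indicator W))"
        unfolding \<U>_def using finW by (intro sum.mono_neutral_right) auto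
      finally show "L y f = (\<Sum>U\<in>\<U>. f (p U) * L y (indicator U))" .
    qed
  qed
qed

end

definition clopen_in :: "'z::topological_space set \<Rightarrow> 'z set \<Rightarrow> bool" where
  "clopen_in D N \<longleftrightarrow> openin (top_of_set D) N \<and> closedin (top_of_set D) N"

lemma clopen_neighbourhood_finite_Ball:
  assumes "finite I" "z0 \<in> D"
    and "\<And>i. i \<in> I \<Longrightarrow> \<exists>N. clopen_in D N \<and> z0 \<in> N \<and> (\<forall>z\<in>N. P i z)"
  shows "\<exists>N. clopen_in D N \<and> z0 \<in> N \<and> (\<forall>z\<in>N. \<forall>i\<in>I. P i z)"
proof -
  obtain N where N: "\<And>i. i \<in> I \<Longrightarrow> clopen_in D (N i) \<and> z0 \<in> N i \<and> (\<forall>z\<in>N i. P i z)"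
    using assms(3) by metis
  let ?N = "D \<inter> (\<Inter>i\<in>I. N i)"
  have "openin (top_of_set D) ?N"
    using openin_Int_Inter[of "N ` I" "top_of_set D" D] assms(1) N by (auto simp: clopen_in_def)
  moreover have "closedin (top_of_set D) ?N"
  proof (cases "I = {}")
    case False
    then have "closedin (top_of_set D) (\<Inter>i\<in>I. N i)"
      using N by (intro closedin_INT) (auto simp: clopen_in_def)
    then show ?thesis by (intro closedin_Int) auto
  qed simp
  ultimately show ?thesis
    using N assms(2) by (intro exI[of _ ?N]) (auto simp: clopen_in_def)
qed

section \<open>Reduction to countably many functions\<close>

text \<open>
  The functional \<open>\<phi>\<close> behaves on \<open>F\<close> like a sum of point masses, one in each \<open>U \<in> \<U>\<close>, as far as
  \<open>F\<close> and the clopen sets with indicator in \<open>F\<close> can tell. The second clause says that nothing is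
  carried outside \<open>\<Union>\<U>\<close>, the third that the mass in \<open>U\<close> sits at a single point, and the last
  that \<open>\<phi> (f indicator U) / \<phi> (indicator U)\<close> behaves like the value of \<open>f\<close> at that point. The existence
  of a point is deliberately not part of the definition, and quotients are multiplied out: in this form
  every clause is a closed condition on the values of \<open>\<phi>\<close>. For the same reason the weights are bounded
  away from zero by \<open>1 / M\<close> instead of being just nonzero; the upper bound \<open>M\<close> is needed to control
  the polynomial estimate below.
\<close>

definition tame :: "('a \<Rightarrow> real) set \<Rightarrow> 'a set \<Rightarrow> 'a set set \<Rightarrow> real \<Rightarrow> (('a \<Rightarrow> real) \<Rightarrow> real) \<Rightarrow> bool" where
  "tame F E \<U> M \<phi> \<longleftrightarrow>
     (\<forall>U\<in>\<U>. 1 / M \<le> \<bar>\<phi> (indicator U)\<bar> \<and> \<bar>\<phi> (indicator U)\<bar> \<le> M) \<and>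
     (\<forall>f\<in>F. \<phi> f = (\<Sum>U\<in>\<U>. \<phi> (\<lambda>x. f x * indicator U x))) \<and>
     (\<forall>U\<in>\<U>. \<forall>V\<in>{V. indicator V \<in> F}.
        \<phi> (indicator (U \<inter> V)) + \<phi> (indicator (U \<inter> - V)) = \<phi> (indicator U) \<and>
        \<phi> (indicator (U \<inter> V)) * \<phi> (indicator (U \<inter> - V)) = 0) \<and>
     (\<forall>U\<in>\<U>. \<forall>V\<in>{V. indicator V \<in> F}. \<forall>f\<in>F. \<forall>a.
        ((\<forall>x\<in>E \<inter> V. f x \<le> a) \<longrightarrow> \<phi> (indicator (U \<inter> V)) = 0 \<or>
           \<phi> (\<lambda>x. f x * indicator U x) * \<phi> (indicator U) \<le> a * (\<phi> (indicator U))\<^sup>2) \<and>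
        ((\<forall>x\<in>E \<inter> V. a \<le> f x) \<longrightarrow> \<phi> (indicator (U \<inter> V)) = 0 \<or>
           a * (\<phi> (indicator U))\<^sup>2 \<le> \<phi> (\<lambda>x. f x * indicator U x) * \<phi> (indicator U)))"

text \<open>
  A countable family \<open>F\<close> closed under the operations of the argument. It determines a countable algebra
  of clopen sets of \<open>X\<close>, and a map of \<open>Y\<close> into the separable metrizable space of real sequences that
  records the functions \<open>L y f\<close> for \<open>f \<in> F\<close>. Closure under multiplication and the two last
  conditions say that \<open>F\<close> is fine enough: powers of recorded functions are recorded, and every
  member of \<open>F\<close> is continuous with respect to the clopen algebra.
\<close>

locale separable_reduction = finitely_supported_surjection +
  fixes F :: "('a \<Rightarrow> real) set"
  assumes F_countable: "countable F" and F_nonempty: "F \<noteq> {}"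
    and F_cont: "f \<in> F \<Longrightarrow> continuous_map X euclideanreal f"
    and F_mult: "\<lbrakk>f \<in> F; h \<in> F\<rbrakk> \<Longrightarrow> (\<lambda>x. f x * h x) \<in> F"
    and F_compl: "f \<in> F \<Longrightarrow> (\<lambda>x. 1 - f x) \<in> F"
    and F_pow: "f \<in> F \<Longrightarrow> \<exists>p\<in>F. \<forall>y\<in>topspace Y. L y p = L y f ^ k"
    and F_sep: "\<lbrakk>f \<in> F; a < b\<rbrakk> \<Longrightarrow> \<exists>U. indicator U \<in> F \<and>
          (\<forall>x\<in>topspace X. (f x \<le> a \<longrightarrow> x \<in> U) \<and> (x \<in> U \<longrightarrow> f x < b))"
begin

definition \<A> :: "'a set set" where "\<A> = {U. indicator U \<in> F}"

lemma \<A>_cont: "U \<in> \<A> \<Longrightarrow> continuous_map X euclideanreal (indicator U :: 'a \<Rightarrow> real)"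
  using F_cont by (simp add: \<A>_def)

lemma \<A>_Int: "\<lbrakk>U \<in> \<A>; V \<in> \<A>\<rbrakk> \<Longrightarrow> U \<inter> V \<in> \<A>"
  using F_mult[of "indicator U" "indicator V"] by (simp add: \<A>_def flip: indicator_inter_arith)

lemma \<A>_Compl: "U \<in> \<A> \<Longrightarrow> - U \<in> \<A>"
  using F_compl[of "indicator U"] by (simp add: \<A>_def flip: indicator_compl)

lemma \<A>_UNIV: "UNIV \<in> \<A>"
proof -
  obtain f where "f \<in> F" using F_nonempty by blast
  then obtain U where "U \<in> \<A>" using F_sep[of f 0 1] by (auto simp: \<A>_def)
  then have "- (U \<inter> - U) \<in> \<A>" by (intro \<A>_Int \<A>_Compl)
  then show ?thesis by simp
qed

lemma \<A>_countable: "countable \<A>"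
proof -
  have "inj_on (indicator :: 'a set \<Rightarrow> 'a \<Rightarrow> real) \<A>"
    by (metis indicator_eq_1_iff inj_onI subsetI subset_antisym)
  moreover have "countable ((indicator :: 'a set \<Rightarrow> 'a \<Rightarrow> real) ` \<A>)"
    by (rule countable_subset[OF _ F_countable]) (auto simp: \<A>_def)
  ultimately show ?thesis by (metis countable_image_inj_on)
qed

lemma F_restrict: "\<lbrakk>f \<in> F; U \<in> \<A>\<rbrakk> \<Longrightarrow> (\<lambda>x. f x * indicator U x) \<in> F"
  using F_mult by (simp add: \<A>_def)

text \<open>
  A sequence \<open>z\<close> is read as a functional. Outside \<open>F\<close> the index \<open>coord f\<close> is an arbitrary default, so
  \<open>ev z f\<close> has a meaning for \<open>f \<in> F\<close> only.
\<close>

definition coord :: "('a \<Rightarrow> real) \<Rightarrow> nat" where "coord = to_nat_on F"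

definition ev :: "(nat \<Rightarrow> real) \<Rightarrow> ('a \<Rightarrow> real) \<Rightarrow> real" where "ev z f = z (coord f)"

definition embed :: "'b \<Rightarrow> nat \<Rightarrow> real" where "embed y j = L y (from_nat_into F j)"

definition S :: "(nat \<Rightarrow> real) set" where "S = embed ` topspace Y"

lemma ev_embed: "f \<in> F \<Longrightarrow> ev (embed y) f = L y f"
  by (simp add: ev_def embed_def coord_def F_countable)

lemma coord_is_ev:
  assumes "z \<in> S" shows "z j = ev z (from_nat_into F j)"
proof -
  obtain y where z: "z = embed y" using assms unfolding S_def by blast
  have "from_nat_into F j \<in> F" using from_nat_into[OF F_nonempty] .
  then show ?thesis by (simp add: z ev_embed) (simp add: embed_def)
qed

lemma continuous_on_ev [continuous_intros]: "continuous_on T (\<lambda>z. ev z f)"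
  unfolding ev_def by (rule continuous_on_subset[OF continuous_on_product_coordinates]) simp

lemma continuous_map_embed: "continuous_map Y (top_of_set S) embed"
proof -
  have "continuous_map Y euclideanreal (\<lambda>y. L y (from_nat_into F j))" for j
    by (intro L_continuous F_cont from_nat_into[OF F_nonempty])
  then have "continuous_map Y (product_topology (\<lambda>_. euclideanreal) UNIV) embed"
    by (simp add: continuous_map_componentwise_UNIV embed_def)
  then show ?thesis
    by (auto simp: euclidean_product_topology continuous_map_in_subtopology S_def)
qed

definition stratum :: "'a set set \<Rightarrow> real \<Rightarrow> (nat \<Rightarrow> real) set" where
  "stratum \<U> M = {z \<in> S. tame F (topspace X) \<U> M (ev z)}"

lemma closedin_stratum: "closedin (top_of_set S) (stratum \<U> M)"
proof -
  have "closed {z. tame F (topspace X) \<U> M (ev z)}"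
    unfolding tame_def Ball_def
    by (intro closed_Collect_conj closed_Collect_all closed_Collect_imp closed_Collect_disj open_Collect_const
        closed_Collect_le closed_Collect_eq continuous_intros closed_Collect_const)
  moreover have "stratum \<U> M = S \<inter> {z. tame F (topspace X) \<U> M (ev z)}"
    unfolding stratum_def by blast
  ultimately show ?thesis by (simp add: closedin_closed_Int)
qed

text \<open>
  The conditions in \<open>tame\<close> are satisfied by the atoms of the functional at \<open>y\<close>. Members of \<open>F\<close>
  are constant on classes of points that the clopen algebra cannot distinguish, so the atomic
  representation applies to all of \<open>F\<close>.
\<close>

lemma strata_cover:
  assumes "z \<in> S"
  shows "\<exists>\<U> m. finite \<U> \<and> \<U> \<subseteq> \<A> \<and> z \<in> stratum \<U> (Suc m)"
proof -
  obtain y where y: "y \<in> topspace Y" and z: "z = embed y" using assms unfolding S_def by blast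
  obtain \<U> p where \<U>: "finite \<U>" "\<U> \<subseteq> \<A>" "disjoint \<U>"
    and p: "\<forall>U\<in>\<U>. p U \<in> topspace X \<inter> U"
    and nz: "\<forall>U\<in>\<U>. L y (indicator U) \<noteq> 0"
    and rep: "\<forall>f. continuous_map X euclideanreal f \<longrightarrow>
         (\<forall>x\<in>topspace X. \<forall>x'\<in>topspace X. (\<forall>V\<in>\<A>. x \<in> V \<longleftrightarrow> x' \<in> V) \<longrightarrow> f x = f x') \<longrightarrow>
         L y f = (\<Sum>U\<in>\<U>. f (p U) * L y (indicator U))"
    by (rule L_atomic_representation[OF y \<A>_cont \<A>_UNIV \<A>_Int \<A>_Compl])
  have const: "f x = f x'"
    if "f \<in> F" "x \<in> topspace X" "x' \<in> topspace X" "\<forall>V\<in>\<A>. x \<in> V \<longleftrightarrow> x' \<in> V" for f x x'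
  proof -
    have no: "\<not> f x < f x'" if x: "x \<in> topspace X" "x' \<in> topspace X" "\<forall>V\<in>\<A>. x \<in> V \<longleftrightarrow> x' \<in> V" for x x'
    proof
      assume "f x < f x'"
      then obtain U where "indicator U \<in> F"
          "\<forall>w\<in>topspace X. (f w \<le> f x \<longrightarrow> w \<in> U) \<and> (w \<in> U \<longrightarrow> f w < f x')"
        using F_sep[OF \<open>f \<in> F\<close>] by blast
      then show False using x unfolding \<A>_def by force
    qed
    show ?thesis using no[of x x'] no[of x' x] that(2-4) by (meson linorder_neqE_linordered_idom)
  qed
  have rep: "ev z f = (\<Sum>U\<in>\<U>. f (p U) * ev z (indicator U))" if "f \<in> F" for f
  proof -
    have "L y f = (\<Sum>U\<in>\<U>. f (p U) * L y (indicator U))"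
      using rep F_cont[OF that] const[OF that] by blast
    moreover have "L y (indicator U) = ev z (indicator U)" if "U \<in> \<U>" for U
      using that \<U>(2) unfolding z \<A>_def by (subst ev_embed) auto
    ultimately show ?thesis using that by (simp add: z ev_embed)
  qed
  have nz: "ev z (indicator U) \<noteq> 0" if "U \<in> \<U>" for U
    using nz that \<U>(2) unfolding z \<A>_def by (subst ev_embed) auto
  have local_rep: "ev z (\<lambda>x. f x * indicator U x) = f (p U) * ev z (indicator U)"
    if "f \<in> F" "U \<in> \<U>" for f U
  proof -
    have "ev z (\<lambda>x. f x * indicator U x) = (\<Sum>W\<in>\<U>. f (p W) * indicator U (p W) * ev z (indicator W))"
      using rep[OF F_restrict] that \<U>(2) by blast
    also have "\<dots> = (\<Sum>W\<in>{U}. f (p W) * indicator U (p W) * ev z (indicator W))"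
    proof (rule sum.mono_neutral_right)
      show "\<forall>W\<in>\<U> - {U}. f (p W) * indicator U (p W) * ev z (indicator W) = 0"
      proof
        fix W assume W: "W \<in> \<U> - {U}"
        then have "W \<inter> U = {}" using \<U>(3) that unfolding disjoint_def by blast
        then have "p W \<notin> U" using p W by blast
        then show "f (p W) * indicator U (p W) * ev z (indicator W) = 0" by simp
      qed
    qed (use \<U>(1) that in auto)
    finally show ?thesis using p that(2) by simp
  qed
  have ind: "ev z (indicator (U \<inter> V)) = indicator V (p U) * ev z (indicator U)" if "U \<in> \<U>" "V \<in> \<A>" for U V
    using local_rep[of "indicator V" U] that
    by (simp add: \<A>_def Int_commute flip: indicator_inter_arith)
  obtain m where m: "\<forall>U\<in>\<U>. \<bar>ev z (indicator U)\<bar> \<le> Suc m \<and> 1 / Suc m \<le> \<bar>ev z (indicator U)\<bar>"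
  proof -
    define m where "m = nat \<lceil>\<Sum>U\<in>\<U>. \<bar>ev z (indicator U)\<bar> + 1 / \<bar>ev z (indicator U)\<bar>\<rceil>"
    have "\<bar>ev z (indicator U)\<bar> \<le> Suc m \<and> 1 / Suc m \<le> \<bar>ev z (indicator U)\<bar>" if "U \<in> \<U>" for U
    proof -
      have "\<bar>ev z (indicator U)\<bar> + 1 / \<bar>ev z (indicator U)\<bar> \<le> (\<Sum>U\<in>\<U>. \<bar>ev z (indicator U)\<bar> + 1 / \<bar>ev z (indicator U)\<bar>)"
        using \<U>(1) that by (intro member_le_sum) auto
      also have "\<dots> \<le> Suc m" unfolding m_def by linarith
      finally have *: "\<bar>ev z (indicator U)\<bar> + 1 / \<bar>ev z (indicator U)\<bar> \<le> Suc m" .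
      have "1 / \<bar>ev z (indicator U)\<bar> > 0" using nz[OF that] by simp
      moreover have "1 / \<bar>ev z (indicator U)\<bar> \<le> Suc m" using * by (smt (verit) abs_ge_zero)
      then have "1 / Suc m \<le> \<bar>ev z (indicator U)\<bar>"
        using nz[OF that] by (simp add: field_simps)
      ultimately show ?thesis using * by linarith
    qed
    then show ?thesis using that by blast
  qed
  have "tame F (topspace X) \<U> (Suc m) (ev z)"
    unfolding tame_def
  proof (intro conjI ballI allI impI)
    fix f assume "f \<in> F"
    then show "ev z f = (\<Sum>U\<in>\<U>. ev z (\<lambda>x. f x * indicator U x))"
      by (simp add: rep local_rep)
  next
    fix U V assume U: "U \<in> \<U>" and "V \<in> {V. indicator V \<in> F}"
    then have "V \<in> \<A>" unfolding \<A>_def by blast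
    then show "ev z (indicator (U \<inter> V)) + ev z (indicator (U \<inter> - V)) = ev z (indicator U)"
      "ev z (indicator (U \<inter> V)) * ev z (indicator (U \<inter> - V)) = 0"
      using ind[OF U] \<A>_Compl by (simp_all add: indicator_def)
  next
    fix U V f a assume U: "U \<in> \<U>" and V: "V \<in> {V. indicator V \<in> F}" and f: "f \<in> F"
    have i: "ev z (indicator (U \<inter> V)) = indicator V (p U) * ev z (indicator U)"
      using ind[OF U] V unfolding \<A>_def by blast
    have sq: "ev z (\<lambda>x. f x * indicator U x) * ev z (indicator U) = f (p U) * (ev z (indicator U))\<^sup>2"
      by (simp add: local_rep[OF f U] power2_eq_square)
    { assume "\<forall>x\<in>topspace X \<inter> V. f x \<le> a"
      then show "ev z (indicator (U \<inter> V)) = 0 \<or>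
          ev z (\<lambda>x. f x * indicator U x) * ev z (indicator U) \<le> a * (ev z (indicator U))\<^sup>2"
        unfolding i sq using p U by (cases "p U \<in> V") (auto intro: mult_right_mono) }
    { assume "\<forall>x\<in>topspace X \<inter> V. a \<le> f x"
      then show "ev z (indicator (U \<inter> V)) = 0 \<or>
          a * (ev z (indicator U))\<^sup>2 \<le> ev z (\<lambda>x. f x * indicator U x) * ev z (indicator U)"
        unfolding i sq using p U by (cases "p U \<in> V") (auto intro: mult_right_mono) }
  qed (use m in auto)
  then show ?thesis using \<U> assms unfolding stratum_def by blast
qed

end

section \<open>Every stratum is zero-dimensional\<close>

context separable_reduction
begin

text \<open>
  On a stratum this is the value of \<open>f\<close> at the atom inside \<open>U\<close>.
\<close>

definition val :: "'a set \<Rightarrow> ('a \<Rightarrow> real) \<Rightarrow> (nat \<Rightarrow> real) \<Rightarrow> real" where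
  "val U f z = ev z (\<lambda>x. f x * indicator U x) / ev z (indicator U)"

context
  fixes \<U> :: "'a set set" and M :: real
  assumes M: "M > 0" and \<U>: "finite \<U>" "\<U> \<subseteq> \<A>"
begin

lemma stratum_weight:
  assumes "z \<in> stratum \<U> M" "U \<in> \<U>"
  shows "ev z (indicator U) \<noteq> 0" "\<bar>ev z (indicator U)\<bar> \<le> M"
proof -
  have "1 / M \<le> \<bar>ev z (indicator U)\<bar>" "\<bar>ev z (indicator U)\<bar> \<le> M"
    using assms unfolding stratum_def tame_def by blast+
  moreover have "1 / M > 0" using M by simp
  ultimately show "ev z (indicator U) \<noteq> 0" "\<bar>ev z (indicator U)\<bar> \<le> M" by linarith+
qed

lemma stratum_split:
  assumes "z \<in> stratum \<U> M" "U \<in> \<U>" "V \<in> \<A>" "ev z (indicator (U \<inter> V)) = 0"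
  shows "ev z (indicator (U \<inter> - V)) \<noteq> 0"
proof -
  have "ev z (indicator (U \<inter> V)) + ev z (indicator (U \<inter> - V)) = ev z (indicator U)"
    using assms unfolding stratum_def tame_def \<A>_def by blast
  then show ?thesis using stratum_weight(1)[OF assms(1,2)] assms(4) by simp
qed

text \<open>
  Exactly one of \<open>U \<inter> V\<close> and \<open>U - V\<close> carries the weight of the atom in \<open>U\<close>, so membership of the
  atom in \<open>V\<close> is an open condition whose negation is again open. This is how the clopen sets of
  \<open>X\<close> produce clopen sets in a stratum.
\<close>

lemma stratum_test_clopen:
  assumes U: "U \<in> \<U>" and V: "V \<in> \<A>"
  shows "clopen_in (stratum \<U> M) {z \<in> stratum \<U> M. ev z (indicator (U \<inter> V)) \<noteq> 0}"
proof -
  let ?D = "stratum \<U> M"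
  have op: "openin (top_of_set ?D) {z \<in> ?D. ev z (indicator W) \<noteq> 0}" for W
  proof -
    have "open {z. ev z (indicator W :: 'a \<Rightarrow> real) \<noteq> 0}"
      by (intro open_Collect_neq continuous_intros)
    then have "openin (top_of_set ?D) (?D \<inter> {z. ev z (indicator W :: 'a \<Rightarrow> real) \<noteq> 0})"
      by (rule openin_open_Int)
    moreover have "?D \<inter> {z. ev z (indicator W) \<noteq> 0} = {z \<in> ?D. ev z (indicator W) \<noteq> 0}" by blast
    ultimately show ?thesis by simp
  qed
  have "ev z (indicator (U \<inter> V)) = 0 \<longleftrightarrow> ev z (indicator (U \<inter> - V)) \<noteq> 0" if z: "z \<in> ?D" for z
  proof -
    have "ev z (indicator (U \<inter> V)) * ev z (indicator (U \<inter> - V)) = 0"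
      using z U V unfolding stratum_def tame_def \<A>_def by blast
    then show ?thesis using stratum_split[OF z U V] by auto
  qed
  then have "?D - {z \<in> ?D. ev z (indicator (U \<inter> V)) \<noteq> 0} = {z \<in> ?D. ev z (indicator (U \<inter> - V)) \<noteq> 0}"
    by blast
  then have "closedin (top_of_set ?D) {z \<in> ?D. ev z (indicator (U \<inter> V)) \<noteq> 0}"
    using op[of "U \<inter> - V"] by (auto simp: closedin_def)
  then show ?thesis using op unfolding clopen_in_def by blast
qed

lemma stratum_representation:
  assumes "z \<in> stratum \<U> M" "f \<in> F"
  shows "ev z f = (\<Sum>U\<in>\<U>. val U f z * ev z (indicator U))"
proof -
  have "ev z f = (\<Sum>U\<in>\<U>. ev z (\<lambda>x. f x * indicator U x))"
    using assms unfolding stratum_def tame_def by blast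
  also have "\<dots> = (\<Sum>U\<in>\<U>. val U f z * ev z (indicator U))"
    by (intro sum.cong refl) (simp add: val_def stratum_weight(1)[OF assms(1)])
  finally show ?thesis .
qed

lemma stratum_val_bounds:
  assumes "z \<in> stratum \<U> M" "U \<in> \<U>" "V \<in> \<A>" "f \<in> F" "ev z (indicator (U \<inter> V)) \<noteq> 0"
  shows "(\<And>x. \<lbrakk>x \<in> topspace X; x \<in> V\<rbrakk> \<Longrightarrow> f x \<le> a) \<Longrightarrow> val U f z \<le> a"
    and "(\<And>x. \<lbrakk>x \<in> topspace X; x \<in> V\<rbrakk> \<Longrightarrow> a \<le> f x) \<Longrightarrow> a \<le> val U f z"
proof -
  let ?m = "ev z (indicator U)"
  have m: "?m \<noteq> 0" by (rule stratum_weight(1)[OF assms(1,2)])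
  then have m2: "?m\<^sup>2 > 0" by simp
  have eq: "ev z (\<lambda>x. f x * indicator U x) * ?m = val U f z * ?m\<^sup>2"
    using m by (simp add: val_def power2_eq_square)
  have t: "((\<forall>x\<in>topspace X \<inter> V. f x \<le> a) \<longrightarrow> ev z (indicator (U \<inter> V)) = 0 \<or>
           ev z (\<lambda>x. f x * indicator U x) * ?m \<le> a * ?m\<^sup>2) \<and>
        ((\<forall>x\<in>topspace X \<inter> V. a \<le> f x) \<longrightarrow> ev z (indicator (U \<inter> V)) = 0 \<or>
           a * ?m\<^sup>2 \<le> ev z (\<lambda>x. f x * indicator U x) * ?m)"
    using assms(1-4) unfolding stratum_def tame_def \<A>_def by blast
  show "val U f z \<le> a" if "\<And>x. \<lbrakk>x \<in> topspace X; x \<in> V\<rbrakk> \<Longrightarrow> f x \<le> a"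
  proof -
    have "val U f z * ?m\<^sup>2 \<le> a * ?m\<^sup>2" using t that assms(5) unfolding eq by auto
    then show ?thesis using m2 by (simp add: mult_le_cancel_right)
  qed
  show "a \<le> val U f z" if "\<And>x. \<lbrakk>x \<in> topspace X; x \<in> V\<rbrakk> \<Longrightarrow> a \<le> f x"
  proof -
    have "a * ?m\<^sup>2 \<le> val U f z * ?m\<^sup>2" using t that assms(5) unfolding eq by auto
    then show ?thesis using m2 by (simp add: mult_le_cancel_right)
  qed
qed

text \<open>
  The atoms move in a zero-dimensional way: with \<open>w\<close> the value at \<open>z0\<close>, two clopen sets between
  \<open>{f \<le> w + e/2}\<close> and \<open>{f < w + e}\<close>, respectively between \<open>{f \<le> w - e}\<close> and \<open>{f < w - e/2}\<close>, enclose the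
  atom of \<open>z0\<close>; the clopen condition on \<open>z\<close> is that its atom stays enclosed. The weights, in contrast,
  need not vary in this way.
\<close>

lemma val_clopen_oscillation:
  assumes z0: "z0 \<in> stratum \<U> M" and U: "U \<in> \<U>" and f: "f \<in> F" and e: "e > 0"
  shows "\<exists>N. clopen_in (stratum \<U> M) N \<and> z0 \<in> N \<and> (\<forall>z\<in>N. \<bar>val U f z - val U f z0\<bar> \<le> e)"
proof -
  let ?D = "stratum \<U> M" and ?w = "val U f z0"
  have "?w + e/2 < ?w + e" "?w - e < ?w - e/2" using e by auto
  then obtain V1 V2 where V1: "indicator V1 \<in> F"
      "\<forall>x\<in>topspace X. (f x \<le> ?w + e/2 \<longrightarrow> x \<in> V1) \<and> (x \<in> V1 \<longrightarrow> f x < ?w + e)"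
    and V2: "indicator V2 \<in> F"
      "\<forall>x\<in>topspace X. (f x \<le> ?w - e \<longrightarrow> x \<in> V2) \<and> (x \<in> V2 \<longrightarrow> f x < ?w - e/2)"
    using F_sep[OF f, of "?w + e/2" "?w + e"] F_sep[OF f, of "?w - e" "?w - e/2"] by metis
  have A: "V1 \<in> \<A>" "V2 \<in> \<A>" "- V1 \<in> \<A>" "- V2 \<in> \<A>" using V1 V2 \<A>_Compl by (auto simp: \<A>_def)
  have n1: "ev z0 (indicator (U \<inter> V1)) \<noteq> 0"
  proof
    assume "ev z0 (indicator (U \<inter> V1)) = 0"
    then have "ev z0 (indicator (U \<inter> - V1)) \<noteq> 0" by (rule stratum_split[OF z0 U A(1)])
    then have "?w + e/2 \<le> ?w"
      by (rule stratum_val_bounds(2)[OF z0 U A(3) f]) (use V1(2) in force)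
    then show False using e by simp
  qed
  have n2: "ev z0 (indicator (U \<inter> - V2)) \<noteq> 0"
  proof
    assume "ev z0 (indicator (U \<inter> - V2)) = 0"
    then have "ev z0 (indicator (U \<inter> - (- V2))) \<noteq> 0" by (rule stratum_split[OF z0 U A(4)])
    then have "ev z0 (indicator (U \<inter> V2)) \<noteq> 0" by simp
    then have "?w \<le> ?w - e/2"
      by (rule stratum_val_bounds(1)[OF z0 U A(2) f]) (use V2(2) in force)
    then show False using e by simp
  qed
  let ?N = "{z \<in> ?D. ev z (indicator (U \<inter> V1)) \<noteq> 0} \<inter> {z \<in> ?D. ev z (indicator (U \<inter> - V2)) \<noteq> 0}"
  have "clopen_in ?D ?N"
    using stratum_test_clopen[OF U A(1)] stratum_test_clopen[OF U A(4)]
    unfolding clopen_in_def by (simp add: openin_Int closedin_Int)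
  moreover have "\<bar>val U f z - ?w\<bar> \<le> e" if z: "z \<in> ?N" for z
  proof -
    have "val U f z \<le> ?w + e"
      by (rule stratum_val_bounds(1)[of z U V1]) (use z U A f V1(2) in force)+
    moreover have "?w - e \<le> val U f z"
      by (rule stratum_val_bounds(2)[of z U "- V2"]) (use z U A f V2(2) in force)+
    ultimately show ?thesis by linarith
  qed
  ultimately show ?thesis using z0 n1 n2 by (intro exI[of _ ?N]) simp
qed

text \<open>
  This is the heart of the proof; it removes the weights. If \<open>g z\<close> denotes \<open>ev z f\<close> and \<open>q k\<close>
  is a member of \<open>F\<close> that is mapped to \<open>g ^ k\<close>, then \<open>g ^ k\<close> is the scalar product of the vector of weights with the vector of values of \<open>q k\<close> at the
  \<open>n\<close> atoms. For \<open>k = 0, ..., n\<close> these value vectors are dependent at \<open>z0\<close>, with coefficients \<open>c\<close>. As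
  the atoms can be kept close to those of \<open>z0\<close> on a clopen set and the weights are bounded, the
  polynomial with coefficients \<open>c\<close> is small at \<open>g z\<close>, whatever the weights at \<open>z\<close> are.
\<close>

lemma coordinate_almost_algebraic:
  assumes z0: "z0 \<in> stratum \<U> M" and f: "f \<in> F"
  obtains c where "\<exists>k\<le>card \<U>. c k \<noteq> 0"
    "\<forall>\<eta>>0. \<exists>N. clopen_in (stratum \<U> M) N \<and> z0 \<in> N \<and>
        (\<forall>z\<in>N. \<bar>\<Sum>k\<le>card \<U>. c k * ev z f ^ k\<bar> < \<eta>)"
proof -
  let ?D = "stratum \<U> M" and ?n = "card \<U>"
  have "\<exists>q. \<forall>k. q k \<in> F \<and> (\<forall>y\<in>topspace Y. L y (q k) = L y f ^ k)"
    using F_pow[OF f] by metis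
  then obtain q where q: "\<And>k. q k \<in> F" "\<And>k y. y \<in> topspace Y \<Longrightarrow> L y (q k) = L y f ^ k" by blast
  have evq: "ev z (q k) = ev z f ^ k" if z: "z \<in> S" for z k
  proof -
    obtain y where "y \<in> topspace Y" "z = embed y" using z unfolding S_def by blast
    then show ?thesis using q f by (simp add: ev_embed)
  qed
  obtain c where c: "\<exists>k\<le>?n. c k \<noteq> 0" "\<forall>U\<in>\<U>. (\<Sum>k\<le>?n. c k * val U (q k) z0) = 0"
    using exists_nontrivial_dependency[OF \<U>(1), of "\<lambda>k U. val U (q k) z0"] by blast
  have "\<exists>N. clopen_in ?D N \<and> z0 \<in> N \<and> (\<forall>z\<in>N. \<bar>\<Sum>k\<le>?n. c k * ev z f ^ k\<bar> < \<eta>)"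
    if \<eta>: "\<eta> > 0" for \<eta>
  proof -
    \<comment> \<open>The error is at most \<open>\<delta> * B\<close> once all values at atoms are within \<open>\<delta>\<close>.\<close>
    define B where "B = (\<Sum>k\<le>?n. \<Sum>U\<in>\<U>. \<bar>c k\<bar> * M)"
    define \<delta> where "\<delta> = \<eta> / (B + 1)"
    have B: "B \<ge> 0" unfolding B_def using M by (intro sum_nonneg) auto
    then have \<delta>: "\<delta> > 0" "\<delta> * B < \<eta>" unfolding \<delta>_def using \<eta> by (auto simp: field_simps)
    have "\<exists>N. clopen_in ?D N \<and> z0 \<in> N \<and>
        (\<forall>z\<in>N. \<forall>(k,U)\<in>{..?n} \<times> \<U>. \<bar>val U (q k) z - val U (q k) z0\<bar> \<le> \<delta>)"
    proof (rule clopen_neighbourhood_finite_Ball)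
      fix i assume "i \<in> {..?n} \<times> \<U>"
      then show "\<exists>N. clopen_in ?D N \<and> z0 \<in> N \<and>
          (\<forall>z\<in>N. case i of (k, U) \<Rightarrow> \<bar>val U (q k) z - val U (q k) z0\<bar> \<le> \<delta>)"
        using val_clopen_oscillation[OF z0 _ q(1) \<delta>(1)] by (cases i) simp
    qed (use \<U>(1) z0 in auto)
    then obtain N where N: "clopen_in ?D N" "z0 \<in> N"
      and close: "\<And>z k U. \<lbrakk>z \<in> N; k \<le> ?n; U \<in> \<U>\<rbrakk> \<Longrightarrow> \<bar>val U (q k) z - val U (q k) z0\<bar> \<le> \<delta>"
      by auto
    have "\<bar>\<Sum>k\<le>?n. c k * ev z f ^ k\<bar> < \<eta>" if zN: "z \<in> N" for z
    proof -
      have z: "z \<in> ?D"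
        using N(1) zN unfolding clopen_in_def by (meson openin_imp_subset subsetD)
      then have zS: "z \<in> S" unfolding stratum_def by blast
      have "(\<Sum>k\<le>?n. \<Sum>U\<in>\<U>. c k * val U (q k) z0 * ev z (indicator U))
          = (\<Sum>U\<in>\<U>. (\<Sum>k\<le>?n. c k * val U (q k) z0) * ev z (indicator U))"
        by (subst sum.swap) (simp add: sum_distrib_right)
      then have zero: "(\<Sum>k\<le>?n. \<Sum>U\<in>\<U>. c k * val U (q k) z0 * ev z (indicator U)) = 0"
        using c(2) by simp
      have "(\<Sum>k\<le>?n. c k * ev z f ^ k) = (\<Sum>k\<le>?n. \<Sum>U\<in>\<U>. c k * val U (q k) z * ev z (indicator U))"
        by (simp add: evq[OF zS, symmetric] stratum_representation[OF z q(1)] sum_distrib_left mult.assoc)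
      also have "\<dots> = (\<Sum>k\<le>?n. \<Sum>U\<in>\<U>. c k * (val U (q k) z - val U (q k) z0) * ev z (indicator U))"
        using zero by (simp add: algebra_simps sum_subtractf)
      finally have "\<bar>\<Sum>k\<le>?n. c k * ev z f ^ k\<bar>
          = \<bar>\<Sum>k\<le>?n. \<Sum>U\<in>\<U>. c k * (val U (q k) z - val U (q k) z0) * ev z (indicator U)\<bar>"
        by (rule arg_cong)
      also have "\<dots> \<le> (\<Sum>k\<le>?n. \<Sum>U\<in>\<U>. \<bar>c k * (val U (q k) z - val U (q k) z0) * ev z (indicator U)\<bar>)"
        by (rule order_trans[OF sum_abs]) (intro sum_mono sum_abs)
      also have "\<dots> \<le> (\<Sum>k\<le>?n. \<Sum>U\<in>\<U>. \<delta> * (\<bar>c k\<bar> * M))"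
      proof (intro sum_mono)
        fix k U assume k: "k \<in> {..?n}" and U: "U \<in> \<U>"
        have "\<bar>c k * (val U (q k) z - val U (q k) z0) * ev z (indicator U)\<bar>
            = \<bar>c k\<bar> * (\<bar>val U (q k) z - val U (q k) z0\<bar> * \<bar>ev z (indicator U)\<bar>)"
          by (simp add: abs_mult)
        also have "\<dots> \<le> \<bar>c k\<bar> * (\<delta> * M)"
          using close[OF zN _ U, of k] k stratum_weight(2)[OF z U] \<delta>(1)
          by (intro mult_left_mono mult_mono) auto
        finally show "\<bar>c k * (val U (q k) z - val U (q k) z0) * ev z (indicator U)\<bar> \<le> \<delta> * (\<bar>c k\<bar> * M)"
          by (simp add: mult_ac)
      qed
      also have "\<dots> = \<delta> * B" unfolding B_def by (simp only: sum_distrib_left)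
      finally show ?thesis using \<delta>(2) by linarith
    qed
    then show ?thesis using N by (intro exI[of _ N] conjI ballI)
  qed
  then show ?thesis by (intro that[OF c(1)]) simp
qed

text \<open>
  A nonzero polynomial has non-roots \<open>t1\<close> and \<open>t2\<close> as close to \<open>ev z0 f\<close> as desired on both sides. On a
  clopen neighbourhood where the polynomial is smaller than at \<open>t1\<close> and \<open>t2\<close>, the coordinate omits
  both values, so cutting there yields a clopen set.
\<close>

lemma coordinate_clopen_oscillation:
  assumes z0: "z0 \<in> stratum \<U> M" and f: "f \<in> F" and e: "e > 0"
  shows "\<exists>H. clopen_in (stratum \<U> M) H \<and> z0 \<in> H \<and> (\<forall>z\<in>H. \<bar>ev z f - ev z0 f\<bar> < e)"
proof -
  let ?D = "stratum \<U> M" and ?g = "ev z0 f"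
  obtain c where nz: "\<exists>k\<le>card \<U>. c k \<noteq> 0"
    and small: "\<forall>\<eta>>0. \<exists>N. clopen_in ?D N \<and> z0 \<in> N \<and>
        (\<forall>z\<in>N. \<bar>\<Sum>k\<le>card \<U>. c k * ev z f ^ k\<bar> < \<eta>)"
    by (rule coordinate_almost_algebraic[OF z0 f])
  define P where "P t = (\<Sum>k\<le>card \<U>. c k * t ^ k)" for t :: real
  have fin: "finite {t. P t = 0}"
    unfolding P_def using nz polyfun_finite_roots[of c "card \<U>"] by blast
  have avoid: "\<exists>t. a < t \<and> t < b \<and> P t \<noteq> 0" if "a < b" for a b
  proof (rule ccontr)
    assume "\<not> ?thesis"
    then have "{a<..<b} \<subseteq> {t. P t = 0}" by auto
    then show False using fin infinite_Ioo[OF \<open>a < b\<close>] finite_subset by blast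
  qed
  obtain t1 where t1: "?g - e < t1" "t1 < ?g" "P t1 \<noteq> 0" using avoid[of "?g - e" ?g] e by auto
  obtain t2 where t2: "?g < t2" "t2 < ?g + e" "P t2 \<noteq> 0" using avoid[of ?g "?g + e"] e by auto
  have "min \<bar>P t1\<bar> \<bar>P t2\<bar> > 0" using t1 t2 by simp
  then obtain N where N: "clopen_in ?D N" "z0 \<in> N"
    and PN: "\<forall>z\<in>N. \<bar>P (ev z f)\<bar> < min \<bar>P t1\<bar> \<bar>P t2\<bar>"
    using small unfolding P_def by blast
  let ?H = "N \<inter> {z. t1 < ev z f \<and> ev z f < t2}"
  have eq: "?H = N \<inter> {z. t1 \<le> ev z f \<and> ev z f \<le> t2}"
  proof -
    have "ev z f \<noteq> t1" "ev z f \<noteq> t2" if "z \<in> N" for z using PN that by force+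
    then show ?thesis by force
  qed
  have "open {z. t1 < ev z f \<and> ev z f < t2}"
    by (intro open_Collect_conj open_Collect_less continuous_intros)
  with N(1) have "openin (top_of_set ?D) ?H"
    unfolding clopen_in_def by (elim conjE) (rule openin_Int_open)
  have "closed {z. t1 \<le> ev z f \<and> ev z f \<le> t2}"
    by (intro closed_Collect_conj closed_Collect_le continuous_intros)
  then have "closedin (top_of_set ?D) (?D \<inter> {z. t1 \<le> ev z f \<and> ev z f \<le> t2})"
    by (rule closedin_closed_Int)
  with N(1) have "closedin (top_of_set ?D) (N \<inter> (?D \<inter> {z. t1 \<le> ev z f \<and> ev z f \<le> t2}))"
    unfolding clopen_in_def by (elim conjE) (rule closedin_Int)
  moreover have "N \<subseteq> ?D" using N(1) unfolding clopen_in_def by (auto dest: openin_imp_subset)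
  then have "N \<inter> (?D \<inter> {z. t1 \<le> ev z f \<and> ev z f \<le> t2}) = ?H" unfolding eq by auto
  ultimately have "closedin (top_of_set ?D) ?H" by simp
  with \<open>openin (top_of_set ?D) ?H\<close> have "clopen_in ?D ?H" unfolding clopen_in_def by blast
  moreover have "\<forall>z\<in>?H. \<bar>ev z f - ?g\<bar> < e" using t1 t2 by auto
  ultimately show ?thesis using N(2) t1 t2 by (intro exI[of _ ?H]) simp
qed

lemma stratum_dim_le_0: "top_of_set (stratum \<U> M) dim_le 0"
  unfolding dimension_le_0_neighbourhood_base_of_clopen neighbourhood_base_of
proof (intro allI impI; elim conjE)
  let ?D = "stratum \<U> M"
  fix W z0 assume W: "openin (top_of_set ?D) W" and z0W: "z0 \<in> W"
  have z0: "z0 \<in> ?D" using W z0W openin_imp_subset by blast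
  then have zS: "z0 \<in> S" unfolding stratum_def by blast
  obtain O' where O': "open O'" "W = ?D \<inter> O'" using W openin_open by blast
  have "openin (product_topology (\<lambda>_. euclideanreal) UNIV) O'"
    using O'(1) by (simp add: euclidean_product_topology)
  then obtain Q where Q: "z0 \<in> (\<Pi>\<^sub>E i\<in>UNIV. Q i)" "\<And>i. open (Q i)" "finite {i. Q i \<noteq> UNIV}"
      "(\<Pi>\<^sub>E i\<in>UNIV. Q i) \<subseteq> O'"
    using product_topology_open_contains_basis[of "\<lambda>_. euclideanreal" UNIV O' z0] z0W O'(2) by auto
  have "\<exists>H. clopen_in ?D H \<and> z0 \<in> H \<and> (\<forall>z\<in>H. \<forall>j\<in>{i. Q i \<noteq> UNIV}. z \<in> S \<and> z j \<in> Q j)"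
  proof (rule clopen_neighbourhood_finite_Ball[OF Q(3) z0])
    fix j
    have "z0 j \<in> Q j" using Q(1) by auto
    then obtain e where e: "e > 0" "\<And>t. dist t (z0 j) < e \<Longrightarrow> t \<in> Q j"
      using Q(2)[of j] by (meson open_dist)
    obtain H where H: "clopen_in ?D H" "z0 \<in> H"
        "\<forall>z\<in>H. \<bar>ev z (from_nat_into F j) - ev z0 (from_nat_into F j)\<bar> < e"
      using coordinate_clopen_oscillation[OF z0 from_nat_into[OF F_nonempty] e(1)] by blast
    have "z \<in> S \<and> z j \<in> Q j" if z: "z \<in> H" for z
    proof -
      have "z \<in> S" using H(1) z unfolding clopen_in_def stratum_def by (auto dest: openin_imp_subset)
      then show ?thesis
        using H(3) z e(2)[of "z j"] coord_is_ev[of z j] coord_is_ev[OF zS, of j]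
        by (simp add: dist_real_def)
    qed
    then show "\<exists>H. clopen_in ?D H \<and> z0 \<in> H \<and> (\<forall>z\<in>H. z \<in> S \<and> z j \<in> Q j)" using H by blast
  qed
  then obtain H where H: "clopen_in ?D H" "z0 \<in> H" "\<forall>z\<in>H. \<forall>j\<in>{i. Q i \<noteq> UNIV}. z j \<in> Q j" by blast
  have "H \<subseteq> W"
  proof
    fix z assume z: "z \<in> H"
    then have "z \<in> (\<Pi>\<^sub>E i\<in>UNIV. Q i)" using H(3) by auto
    moreover have "z \<in> ?D" using H(1) z unfolding clopen_in_def by (auto dest: openin_imp_subset)
    ultimately show "z \<in> W" using Q(4) O'(2) by blast
  qed
  then show "\<exists>U V. openin (top_of_set ?D) U \<and> (closedin (top_of_set ?D) V \<and> openin (top_of_set ?D) V) \<and>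
      z0 \<in> U \<and> U \<subseteq> V \<and> V \<subseteq> W"
    using H unfolding clopen_in_def by (intro exI[of _ H]) simp
qed

end

text \<open>
  Strata are indexed by a finite subfamily of a countable algebra and a natural number, so there are
  countably many.
\<close>

lemma ultranormal_S: "ultranormal_space (top_of_set S)"
proof -
  let ?I = "{\<U>. finite \<U> \<and> \<U> \<subseteq> \<A>} \<times> (UNIV :: nat set)"
  let ?C = "\<lambda>n. (\<lambda>(\<U>, m). stratum \<U> (Suc m)) (from_nat_into ?I n)"
  have ne: "?I \<noteq> {}" by auto
  have "countable {\<U>. finite \<U> \<and> \<U> \<subseteq> \<A>}"
    by (rule countable_Collect_finite_subset[OF \<A>_countable])
  then have countI: "countable ?I" by simp
  show ?thesis
  proof (rule countable_closed_sum_ultranormal[where C = ?C])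
    show "normal_space (top_of_set S)"
      by (intro metrizable_imp_normal_space metrizable_space_subtopology metrizable_space_euclidean)
    show "closedin (top_of_set S) (?C n)" for n
      by (simp add: case_prod_unfold closedin_stratum)
    show "topspace (top_of_set S) = (\<Union>n. ?C n)"
    proof -
      have "(\<Union>n. ?C n) = (\<Union>(\<U>, m)\<in>?I. stratum \<U> (Suc m))"
      proof -
        have "(\<Union>n. ?C n) = \<Union>((\<lambda>(\<U>, m). stratum \<U> (Suc m)) ` range (from_nat_into ?I))"
          by (simp only: image_image)
        then show ?thesis unfolding range_from_nat_into[OF ne countI] .
      qed
      moreover have "\<dots> = S" using strata_cover unfolding stratum_def by fastforce
      ultimately show ?thesis by simp
    qed
    fix n
    obtain \<U> m where i: "from_nat_into ?I n = (\<U>, m)" "finite \<U>" "\<U> \<subseteq> \<A>"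
      using from_nat_into[OF ne, of n] by auto
    let ?D = "stratum \<U> (Suc m)"
    have "subtopology (top_of_set S) (?C n) = top_of_set ?D"
      using i(1) by (simp add: subtopology_subtopology stratum_def Int_def)
    moreover have "ultranormal_space (top_of_set ?D)"
    proof (rule Lindelof_dim_le_0_imp_ultranormal_space)
      show "Lindelof_space (top_of_set ?D)"
      proof (unfold Lindelof_space_def, intro allI impI, elim conjE)
        fix \<V> assume op: "\<forall>V\<in>\<V>. openin (top_of_set ?D) V" and cov: "\<Union>\<V> = topspace (top_of_set ?D)"
        obtain \<V>' where "\<V>' \<subseteq> \<V>" "countable \<V>'" "\<Union>\<V>' = \<Union>\<V>"
          by (rule Lindelof_openin[OF op[rule_format]])
        then show "\<exists>\<V>'. countable \<V>' \<and> \<V>' \<subseteq> \<V> \<and> \<Union>\<V>' = topspace (top_of_set ?D)"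
          using cov by (intro exI[of _ \<V>']) simp
      qed
      show "top_of_set ?D dim_le 0" by (rule stratum_dim_le_0) (use i in auto)
    qed
    ultimately show "ultranormal_space (subtopology (top_of_set S) (?C n))" by simp
  qed
qed

text \<open>
  A clopen separation in the separable image is pulled back to \<open>Y\<close>.
\<close>

lemma clopen_separation:
  assumes "f \<in> F"
  shows "\<exists>H. openin Y H \<and> closedin Y H \<and>
           (\<forall>y\<in>topspace Y. (L y f \<le> 0 \<longrightarrow> y \<in> H) \<and> (y \<in> H \<longrightarrow> L y f < 1))"
proof -
  let ?A = "S \<inter> {z. ev z f \<le> 0}" and ?B = "S \<inter> {z. 1 \<le> ev z f}"
  have "closed {z. ev z f \<le> 0}" "closed {z. 1 \<le> ev z f}"
    by (intro closed_Collect_le continuous_intros)+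
  then have "closedin (top_of_set S) ?A" "closedin (top_of_set S) ?B" by (simp_all add: closedin_closed_Int)
  moreover have "?A \<inter> ?B = {}" by auto
  ultimately obtain H where H: "openin (top_of_set S) H" "closedin (top_of_set S) H" "?A \<subseteq> H" "?B \<inter> H = {}"
    by (rule ultranormal_spaceE[OF ultranormal_S])
  let ?H = "{y \<in> topspace Y. embed y \<in> H}"
  have "openin Y ?H" "closedin Y ?H"
    using openin_continuous_map_preimage[OF continuous_map_embed H(1)]
      closedin_continuous_map_preimage[OF continuous_map_embed H(2)] by auto
  moreover have "(L y f \<le> 0 \<longrightarrow> y \<in> ?H) \<and> (y \<in> ?H \<longrightarrow> L y f < 1)" if y: "y \<in> topspace Y" for y
  proof -
    have "embed y \<in> S" "ev (embed y) f = L y f" using y assms by (simp_all add: S_def ev_embed)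
    then show ?thesis using H(3,4) y by force
  qed
  ultimately show ?thesis by blast
qed

end

section \<open>Existence of the countable reduction\<close>

text \<open>
  Clopen sets are chosen only for rational levels, which keeps the number of operations countable;
  arbitrary levels \<open>a < b\<close> are served by rationals in between.
\<close>

lemma (in finitely_supported_surjection) separable_reduction_exists:
  assumes f0: "continuous_map X euclideanreal f0"
  shows "\<exists>F. f0 \<in> F \<and> separable_reduction X Y L F"
proof -
  let ?C = "{f. continuous_map X euclideanreal f}"
  have "\<exists>p. p \<in> ?C \<and> (\<forall>y\<in>topspace Y. L y p = L y f ^ k)"
    if "f \<in> ?C" for f k
    using L_surjective[OF continuous_map_real_pow[OF L_continuous, of f k]] that by simp
  then have "\<forall>k f. \<exists>p. f \<in> ?C \<longrightarrow> p \<in> ?C \<and> (\<forall>y\<in>topspace Y. L y p = L y f ^ k)" by blast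
  then obtain pow where pow: "\<forall>k f. f \<in> ?C \<longrightarrow> pow k f \<in> ?C \<and> (\<forall>y\<in>topspace Y. L y (pow k f) = L y f ^ k)"
    unfolding choice_iff by (elim exE)
  define separates where "separates a b f h \<longleftrightarrow> a < b \<longrightarrow> (\<exists>U. h = indicator U \<and>
      (\<forall>x\<in>topspace X. (f x \<le> a \<longrightarrow> x \<in> U) \<and> (x \<in> U \<longrightarrow> f x < b)))"
    for a b :: real and f h :: "'a \<Rightarrow> real"
  have "\<exists>h. f \<in> ?C \<longrightarrow> h \<in> ?C \<and> separates a b f h" for f a b
  proof (cases "a < b")
    case True
    then show ?thesis using zero_dim[of f a b] unfolding separates_def by auto
  qed (auto simp: separates_def)
  then have "\<forall>a b f. \<exists>h. f \<in> ?C \<longrightarrow> h \<in> ?C \<and> separates a b f h" by (intro allI)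
  then obtain sep where sep: "\<forall>a b f. f \<in> ?C \<longrightarrow> sep a b f \<in> ?C \<and> separates a b f (sep a b f)"
    unfolding choice_iff by (elim exE)
  define Ops where "Ops = {\<lambda>f h x. f x * h x, \<lambda>f h x. 1 - f x} \<union> range (\<lambda>k f h. pow k f)
      \<union> range (\<lambda>(a, b) f h. sep (of_rat a) (of_rat b) f)"
  have "countable Ops" unfolding Ops_def by simp
  moreover have "op f h \<in> ?C" if "op \<in> Ops" "f \<in> ?C" "h \<in> ?C" for op f h
    using that pow sep unfolding Ops_def by (auto intro!: continuous_intros)
  ultimately obtain F where F: "countable F" "{f0} \<subseteq> F" "F \<subseteq> ?C"
      and closed: "\<forall>op\<in>Ops. \<forall>f\<in>F. \<forall>h\<in>F. op f h \<in> F"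
    using countable_closure_exists[of Ops "{f0}" ?C] f0 by auto
  have "separable_reduction X Y L F"
  proof unfold_locales
    show "countable F" "F \<noteq> {}" using F by auto
    show "continuous_map X euclideanreal f" if "f \<in> F" for f using F that by blast
    show "(\<lambda>x. f x * h x) \<in> F" if "f \<in> F" "h \<in> F" for f h
      using bspec[OF closed, of "\<lambda>f h x. f x * h x"] that by (simp add: Ops_def)
    show "(\<lambda>x. 1 - f x) \<in> F" if "f \<in> F" for f
      using bspec[OF closed, of "\<lambda>f h x. 1 - f x"] that by (simp add: Ops_def) blast
    show "\<exists>p\<in>F. \<forall>y\<in>topspace Y. L y p = L y f ^ k" if f: "f \<in> F" for f k
    proof -
      have "pow k f \<in> F" using bspec[OF closed, of "\<lambda>f h. pow k f"] f by (simp add: Ops_def) blast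
      moreover have "\<forall>y\<in>topspace Y. L y (pow k f) = L y f ^ k" using pow f F(3) by blast
      ultimately show ?thesis by blast
    qed
    show "\<exists>U. indicator U \<in> F \<and> (\<forall>x\<in>topspace X. (f x \<le> a \<longrightarrow> x \<in> U) \<and> (x \<in> U \<longrightarrow> f x < b))"
      if f: "f \<in> F" and "a < b" for f and a b :: real
    proof -
      obtain r where r: "a < of_rat r" "of_rat r < b" using of_rat_dense[OF \<open>a < b\<close>] by blast
      obtain q where q: "a < of_rat q" "(of_rat q :: real) < of_rat r" using of_rat_dense[OF r(1)] by blast
      have "(\<lambda>f h. sep (of_rat q) (of_rat r) f) \<in> Ops"
        unfolding Ops_def by (auto intro: range_eqI[of _ _ "(q, r)"])
      from bspec[OF closed this] have "sep (of_rat q) (of_rat r) f \<in> F" using f by blast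
      moreover obtain U where U: "sep (of_rat q) (of_rat r) f = indicator U"
          "\<forall>x\<in>topspace X. (f x \<le> of_rat q \<longrightarrow> x \<in> U) \<and> (x \<in> U \<longrightarrow> f x < of_rat r)"
        using sep[rule_format, of f "of_rat q" "of_rat r"] f F(3) q(2) unfolding separates_def by auto
      ultimately have "indicator U \<in> F" by simp
      moreover have "(f x \<le> a \<longrightarrow> x \<in> U) \<and> (x \<in> U \<longrightarrow> f x < b)" if "x \<in> topspace X" for x
        using bspec[OF U(2) that] q r by linarith
      ultimately show ?thesis by blast
    qed
  qed
  then show ?thesis using F(2) by blast
qed

lemma (in finitely_supported_surjection) codomain_zero_dim:
  assumes g: "continuous_map Y euclideanreal g"
  shows "\<exists>H. openin Y H \<and> closedin Y H \<and>
           (\<forall>y\<in>topspace Y. (g y \<le> 0 \<longrightarrow> y \<in> H) \<and> (y \<in> H \<longrightarrow> g y < 1))"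
proof -
  obtain f where f: "continuous_map X euclideanreal f" "\<forall>y\<in>topspace Y. L y f = g y"
    using L_surjective[OF g] by blast
  obtain F where "f \<in> F" "separable_reduction X Y L F" using separable_reduction_exists[OF f(1)] by blast
  then show ?thesis using separable_reduction.clopen_separation[of X Y L F f] f(2) by auto
qed

section \<open>Covering dimension zero and clopen separation\<close>

lemma continuous_map_indicator_iff_clopen:
  "continuous_map X euclideanreal (indicator U) \<longleftrightarrow>
     openin X (topspace X \<inter> U) \<and> closedin X (topspace X \<inter> U)"
proof
  assume c: "continuous_map X euclideanreal (indicator U)"
  have "topspace X \<inter> U = {x \<in> topspace X. indicator U x \<in> {1/2::real<..}}"
    "topspace X \<inter> U = {x \<in> topspace X. indicator U x \<in> {1/2::real..}}"
    by (auto simp: indicator_def)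
  then show "openin X (topspace X \<inter> U) \<and> closedin X (topspace X \<inter> U)"
    using openin_continuous_map_preimage[OF c, of "{1/2<..}"]
      closedin_continuous_map_preimage[OF c, of "{1/2..}"] by simp
next
  assume U: "openin X (topspace X \<inter> U) \<and> closedin X (topspace X \<inter> U)"
  then have U': "openin X (topspace X - U)" by (auto simp: closedin_def Diff_Int)
  show "continuous_map X euclideanreal (indicator U)"
    unfolding continuous_map_def
  proof (intro conjI allI impI)
    fix W :: "real set"
    have "{x \<in> topspace X. indicator U x \<in> W}
        = (if 1 \<in> W then topspace X \<inter> U else {}) \<union> (if 0 \<in> W then topspace X - U else {})"
      by (auto simp: indicator_def split: if_splits)
    then show "openin X {x \<in> topspace X. indicator U x \<in> W}" using U U' by auto
  qed simp
qed

lemma functionally_open_clopen: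
  assumes "openin X U" "closedin X U"
  shows "functionally_open X U"
proof -
  have "topspace X \<inter> U = U" using openin_subset[OF assms(1)] by blast
  then have "continuous_map X euclideanreal (indicator U)"
    using assms by (simp add: continuous_map_indicator_iff_clopen)
  then show ?thesis unfolding functionally_open_def
    using openin_subset[OF assms(1)] by (intro exI[of _ "indicator U"]) (auto simp: indicator_def)
qed

lemma functionally_open_imp_openin:
  assumes "functionally_open X U" shows "openin X U"
proof -
  obtain f where f: "continuous_map X euclideanreal f" "U = {x \<in> topspace X. f x \<noteq> 0}"
    using assms unfolding functionally_open_def by blast
  then show ?thesis using openin_continuous_map_preimage[OF f(1), of "- {0}"] by (simp add: open_Compl)
qed

lemma covering_dim_eq_0_iff: "covering_dim X = 0 \<longleftrightarrow> covering_dim_le X 0"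
proof
  assume 0: "covering_dim X = 0"
  have "{enat n |n. covering_dim_le X n} \<noteq> {}"
  proof
    assume "{enat n |n. covering_dim_le X n} = {}"
    then have "covering_dim X = \<infinity>" unfolding covering_dim_def by (simp only: Inf_enat_def simp_thms if_True)
    then show False using 0 by simp
  qed
  then have "covering_dim X \<in> {enat n |n. covering_dim_le X n}"
    unfolding covering_dim_def Inf_enat_def by (simp only: if_False) (rule LeastI_ex, auto)
  then show "covering_dim_le X 0" using 0 by (auto simp: zero_enat_def)
next
  assume "covering_dim_le X 0"
  then have "covering_dim X \<le> 0" unfolding covering_dim_def zero_enat_def by (intro Inf_lower) blast
  then show "covering_dim X = 0" by simp
qed

text \<open>
  A refinement of the cover \<open>{f < b}\<close>, \<open>{f > a}\<close> in which no two members meet is a partition into open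
  sets; the union of the members inside \<open>{f < b}\<close> is therefore clopen.
\<close>

lemma covering_dim_0_imp_clopen_separation:
  assumes dim: "covering_dim_le X 0" and f: "continuous_map X euclideanreal f" and ab: "a < b"
  shows "\<exists>U. continuous_map X euclideanreal (indicator U) \<and>
            (\<forall>x\<in>topspace X. (f x \<le> a \<longrightarrow> x \<in> U) \<and> (x \<in> U \<longrightarrow> f x < b))"
proof -
  define P where "P = {x \<in> topspace X. f x < b}"
  define Q where "Q = {x \<in> topspace X. a < f x}"
  have "functionally_open X P"
    unfolding functionally_open_def P_def
    using f by (intro exI[of _ "\<lambda>x. max (b - f x) 0"]) (auto intro!: continuous_intros)
  moreover have "functionally_open X Q"
    unfolding functionally_open_def Q_def
    using f by (intro exI[of _ "\<lambda>x. max (f x - a) 0"]) (auto intro!: continuous_intros)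
  moreover have "P \<union> Q = topspace X" unfolding P_def Q_def using ab by auto
  ultimately have "finite_functionally_open_cover X {P, Q}"
    by (simp add: finite_functionally_open_cover_def)
  then obtain \<V> where \<V>: "finite_functionally_open_cover X \<V>" "\<forall>V\<in>\<V>. \<exists>U\<in>{P, Q}. V \<subseteq> U"
      and ord: "\<forall>x\<in>topspace X. card {V \<in> \<V>. x \<in> V} \<le> 0 + 1"
    using dim unfolding covering_dim_le_def by meson
  have fin: "finite \<V>" and cov: "\<Union>\<V> = topspace X" and op: "\<And>V. V \<in> \<V> \<Longrightarrow> openin X V"
    using \<V>(1) functionally_open_imp_openin unfolding finite_functionally_open_cover_def by auto
  have disj: "V = W" if "V \<in> \<V>" "W \<in> \<V>" "x \<in> V" "x \<in> W" for V W x
  proof -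
    have "card {V \<in> \<V>. x \<in> V} \<le> Suc 0" using ord cov that by auto
    then show ?thesis using that fin by (subst (asm) card_le_Suc0_iff_eq) auto
  qed
  define U where "U = \<Union>{V \<in> \<V>. V \<subseteq> P}"
  define W where "W = \<Union>{V \<in> \<V>. \<not> V \<subseteq> P}"
  have UW: "openin X U" "openin X W" unfolding U_def W_def using op by auto
  have "U \<inter> W = {}" unfolding U_def W_def using disj by auto
  moreover have cup: "U \<union> W = topspace X" unfolding U_def W_def cov[symmetric] by blast
  ultimately have "topspace X - U = W" by auto
  then have "closedin X U" using UW by (simp add: closedin_def openin_subset)
  moreover have "topspace X \<inter> U = U" using openin_subset[OF UW(1)] by auto
  ultimately have "continuous_map X euclideanreal (indicator U)"
    using UW by (simp add: continuous_map_indicator_iff_clopen)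
  moreover have "U \<subseteq> P" unfolding U_def by auto
  moreover have "W \<subseteq> Q" unfolding W_def using \<V>(2) by auto
  ultimately show ?thesis using cup unfolding P_def Q_def by (intro exI[of _ U]) force
qed

text \<open>
  If the cover is given by the cozero sets of \<open>u U\<close> and \<open>s\<close> is the sum of the \<open>\<bar>u U\<bar>\<close>, then at each
  point some \<open>\<bar>u U\<bar>\<close> is at least the average share of \<open>s\<close>. Separating \<open>{\<bar>u U\<bar> \<ge> s / m}\<close> from the zero
  set of \<open>u U\<close> by a clopen set \<open>C U\<close> thus gives a clopen shrinking that still covers, and the
  atoms \<open>V J\<close> of these clopen sets form the disjoint refinement.
\<close>

lemma clopen_separation_imp_covering_dim_0:
  assumes sep: "\<And>g. continuous_map Y euclideanreal g \<Longrightarrow> \<exists>H. openin Y H \<and> closedin Y H \<and>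
            (\<forall>y\<in>topspace Y. (g y \<le> 0 \<longrightarrow> y \<in> H) \<and> (y \<in> H \<longrightarrow> g y < 1))"
  shows "covering_dim_le Y 0"
  unfolding covering_dim_le_def
proof (intro allI impI)
  fix \<U> assume "finite_functionally_open_cover Y \<U>"
  then have fin: "finite \<U>" and cov: "\<Union>\<U> = topspace Y"
    and "\<forall>U\<in>\<U>. \<exists>u. continuous_map Y euclideanreal u \<and> U = {x \<in> topspace Y. u x \<noteq> 0}"
    unfolding finite_functionally_open_cover_def functionally_open_def by simp_all
  from bchoice[OF this(3)] obtain u where
    u: "\<And>U. U \<in> \<U> \<Longrightarrow> continuous_map Y euclideanreal (u U)"
      "\<And>U. U \<in> \<U> \<Longrightarrow> U = {x \<in> topspace Y. u U x \<noteq> 0}" by auto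
  define s where "s y = (\<Sum>U\<in>\<U>. \<bar>u U y\<bar>)" for y
  have s_cont: "continuous_map Y euclideanreal s"
    unfolding s_def using u fin by (intro continuous_intros) auto
  have s_pos: "s y > 0" if y: "y \<in> topspace Y" for y
  proof -
    obtain U where "U \<in> \<U>" "y \<in> U" using cov y by blast
    then have "u U y \<noteq> 0" using u(2) by blast
    then show ?thesis unfolding s_def using \<open>U \<in> \<U>\<close> fin by (intro sum_pos2[of _ U]) auto
  qed
  \<comment> \<open>The successor keeps \<open>m\<close> positive and makes the share strictly less than the average.\<close>
  define m where "m = real (Suc (card \<U>))"
  have "\<exists>H. openin Y H \<and> closedin Y H \<and>
      (\<forall>y\<in>topspace Y. (s y \<le> m * \<bar>u U y\<bar> \<longrightarrow> y \<in> H) \<and> (y \<in> H \<longrightarrow> y \<in> U))" if U: "U \<in> \<U>" for U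
  proof -
    have "continuous_map Y euclideanreal (\<lambda>y. 1 - m * \<bar>u U y\<bar> / s y)"
      using u(1)[OF U] s_cont less_imp_neq[OF s_pos] by (intro continuous_intros) auto
    from sep[OF this] obtain H where H: "openin Y H" "closedin Y H"
      "\<forall>y\<in>topspace Y. (1 - m * \<bar>u U y\<bar> / s y \<le> 0 \<longrightarrow> y \<in> H) \<and> (y \<in> H \<longrightarrow> 1 - m * \<bar>u U y\<bar> / s y < 1)"
      by blast
    have "(s y \<le> m * \<bar>u U y\<bar> \<longrightarrow> y \<in> H) \<and> (y \<in> H \<longrightarrow> y \<in> U)" if y: "y \<in> topspace Y" for y
    proof (intro conjI impI)
      assume "s y \<le> m * \<bar>u U y\<bar>"
      then have "1 - m * \<bar>u U y\<bar> / s y \<le> 0" using s_pos[OF y] by (simp add: field_simps)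
      then show "y \<in> H" using H(3) y by blast
    next
      assume "y \<in> H"
      then have "1 - m * \<bar>u U y\<bar> / s y < 1" using H(3) y by blast
      then have "u U y \<noteq> 0" by auto
      then show "y \<in> U" using u(2)[OF U] y by auto
    qed
    then show ?thesis using H by blast
  qed
  then have "\<forall>U\<in>\<U>. \<exists>H. openin Y H \<and> closedin Y H \<and>
      (\<forall>y\<in>topspace Y. (s y \<le> m * \<bar>u U y\<bar> \<longrightarrow> y \<in> H) \<and> (y \<in> H \<longrightarrow> y \<in> U))" by (rule ballI)
  from bchoice[OF this] obtain C where C: "\<And>U. U \<in> \<U> \<Longrightarrow> openin Y (C U)" "\<And>U. U \<in> \<U> \<Longrightarrow> closedin Y (C U)"
      "\<And>U y. \<lbrakk>U \<in> \<U>; y \<in> topspace Y; s y \<le> m * \<bar>u U y\<bar>\<rbrakk> \<Longrightarrow> y \<in> C U"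
      "\<And>U y. \<lbrakk>U \<in> \<U>; y \<in> topspace Y; y \<in> C U\<rbrakk> \<Longrightarrow> y \<in> U"
    by auto
  have C_cov: "\<exists>U\<in>\<U>. y \<in> C U" if y: "y \<in> topspace Y" for y
  proof (rule ccontr)
    assume "\<not> ?thesis"
    then have "\<bar>u U y\<bar> \<le> s y / m" if "U \<in> \<U>" for U
      using C(3)[OF that y] that unfolding m_def by (force simp: field_simps)
    then have "s y \<le> (\<Sum>U\<in>\<U>. s y / m)" unfolding s_def[of y] by (intro sum_mono) (simp add: s_def)
    also have "\<dots> = card \<U> * (s y / m)" by simp
    also have "\<dots> < s y" using s_pos[OF y] unfolding m_def by (simp add: field_simps)
    finally show False by simp
  qed
  define V where "V J = {y \<in> topspace Y. {U \<in> \<U>. y \<in> C U} = J}" for J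
  have V_clopen: "openin Y (V J) \<and> closedin Y (V J)" if J: "J \<subseteq> \<U>" for J
  proof -
    have eq: "V J = topspace Y \<inter> (\<Inter>U\<in>\<U>. if U \<in> J then C U else topspace Y - C U)"
      unfolding V_def using J by (auto split: if_splits)
    have cl: "openin Y (if U \<in> J then C U else topspace Y - C U)"
      "closedin Y (if U \<in> J then C U else topspace Y - C U)" if "U \<in> \<U>" for U
      using C(1,2)[OF that] by (auto intro: closedin_diff)
    show ?thesis
    proof (cases "\<U> = {}")
      case True
      then show ?thesis unfolding eq by simp
    next
      case False
      have "openin Y (\<Inter>U\<in>\<U>. if U \<in> J then C U else topspace Y - C U)"
        using cl(1) fin False by (intro openin_INT2) auto
      moreover have "closedin Y (\<Inter>U\<in>\<U>. if U \<in> J then C U else topspace Y - C U)"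
        using cl(2) False by (intro closedin_INT) auto
      ultimately show ?thesis unfolding eq by (simp add: openin_Int closedin_Int)
    qed
  qed
  let ?\<V> = "V ` (Pow \<U> - {{}})"
  have "finite_functionally_open_cover Y ?\<V>"
    unfolding finite_functionally_open_cover_def
  proof (intro conjI ballI)
    show "finite ?\<V>" using fin by simp
    show "functionally_open Y W" if "W \<in> ?\<V>" for W
      using that V_clopen by (auto intro: functionally_open_clopen)
    show "\<Union>?\<V> = topspace Y"
    proof
      show "\<Union>?\<V> \<subseteq> topspace Y" unfolding V_def by auto
      show "topspace Y \<subseteq> \<Union>?\<V>"
      proof
        fix y assume y: "y \<in> topspace Y"
        then have "{U \<in> \<U>. y \<in> C U} \<in> Pow \<U> - {{}}" using C_cov by auto
        moreover have "y \<in> V {U \<in> \<U>. y \<in> C U}" unfolding V_def using y by simp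
        ultimately show "y \<in> \<Union>?\<V>" by blast
      qed
    qed
  qed
  moreover have "\<forall>W\<in>?\<V>. \<exists>U\<in>\<U>. W \<subseteq> U"
  proof
    fix W assume "W \<in> ?\<V>"
    then obtain J U where J: "W = V J" "J \<subseteq> \<U>" "U \<in> J" by auto
    then have "W \<subseteq> U" unfolding V_def using C(4) by auto
    then show "\<exists>U\<in>\<U>. W \<subseteq> U" using J by auto
  qed
  moreover have "\<forall>y\<in>topspace Y. card {W \<in> ?\<V>. y \<in> W} \<le> 0 + 1"
  proof
    fix y assume "y \<in> topspace Y"
    have "{W \<in> ?\<V>. y \<in> W} \<subseteq> {V {U \<in> \<U>. y \<in> C U}}" unfolding V_def by auto
    then have "card {W \<in> ?\<V>. y \<in> W} \<le> card {V {U \<in> \<U>. y \<in> C U}}" by (intro card_mono) auto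
    then show "card {W \<in> ?\<V>. y \<in> W} \<le> 0 + 1" by simp
  qed
  ultimately show "\<exists>\<V>. finite_functionally_open_cover Y \<V> \<and> (\<forall>V\<in>\<V>. \<exists>U\<in>\<U>. V \<subseteq> U) \<and>
      (\<forall>x\<in>topspace Y. card {V \<in> \<V>. x \<in> V} \<le> 0 + 1)"
    by (intro exI[of _ ?\<V>] conjI)
qed

section \<open>Linear continuous surjections between function spaces\<close>

lemma restrict_in_Cp:
  assumes "continuous_map X euclideanreal f"
  shows "restrict f (topspace X) \<in> topspace (Cp X)"
proof -
  have "continuous_map X euclideanreal (restrict f (topspace X))"
    by (rule continuous_map_eq[OF assms]) simp
  then show ?thesis by (simp add: topspace_Cp)
qed

text \<open>
  A basic neighbourhood of zero on which the functional is bounded by 1 restricts only finitely many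
  coordinates. If \<open>f\<close> vanishes there, all multiples of \<open>f\<close> lie in the neighbourhood, so the functional
  is bounded on the line through \<open>f\<close>, hence zero.
\<close>

lemma continuous_functional_finite_support:
  assumes cont: "continuous_map (Cp X) (Cp Y) T" and y: "y \<in> topspace Y"
    and scale: "\<And>c f. continuous_map X euclideanreal f \<Longrightarrow>
          T (restrict (\<lambda>x. c * f x) (topspace X)) y = c * T (restrict f (topspace X)) y"
  shows "\<exists>F. finite F \<and> F \<subseteq> topspace X \<and>
          (\<forall>f. continuous_map X euclideanreal f \<longrightarrow> (\<forall>x\<in>F. f x = 0) \<longrightarrow> T (restrict f (topspace X)) y = 0)"
proof -
  let ?E = "topspace X"
  have "continuous_map (Cp Y) euclideanreal (\<lambda>g. g y)"
    unfolding Cp_def using y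
    by (intro continuous_map_from_subtopology continuous_map_product_projection)
  then have "continuous_map (Cp X) euclideanreal (\<lambda>f. T f y)"
    using continuous_map_compose[OF cont] by (simp add: comp_def)
  then have "openin (Cp X) {f \<in> topspace (Cp X). T f y \<in> {-1<..<1}}"
    by (rule openin_continuous_map_preimage) simp
  then obtain W where W: "openin (product_topology (\<lambda>_. euclideanreal) ?E) W"
      "{f \<in> topspace (Cp X). T f y \<in> {-1<..<1}} = W \<inter> {f. continuous_map X euclideanreal f}"
    unfolding Cp_def openin_subtopology by blast
  let ?z = "restrict (\<lambda>_. 0) ?E :: 'a \<Rightarrow> real"
  have z: "?z \<in> topspace (Cp X)" by (rule restrict_in_Cp) simp
  have "T ?z y = 0" using scale[of "\<lambda>_. 0" 0] by simp
  then have "?z \<in> {f \<in> topspace (Cp X). T f y \<in> {-1<..<1}}" using z by simp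
  then have "?z \<in> W" unfolding W(2) by simp
  from product_topology_open_contains_basis[OF W(1) this] obtain Q where
      Q: "?z \<in> (\<Pi>\<^sub>E i\<in>?E. Q i)" "finite {i. Q i \<noteq> UNIV}" "(\<Pi>\<^sub>E i\<in>?E. Q i) \<subseteq> W"
    unfolding topspace_euclidean by (elim exE conjE)
  let ?F = "{i. Q i \<noteq> UNIV} \<inter> ?E"
  have "T (restrict f ?E) y = 0" if f: "continuous_map X euclideanreal f" and f0: "\<forall>x\<in>?F. f x = 0" for f
  proof (rule ccontr)
    assume nz: "T (restrict f ?E) y \<noteq> 0"
    define c where "c = 1 / T (restrict f ?E) y"
    let ?h = "restrict (\<lambda>x. c * f x) ?E"
    have "?h \<in> topspace (Cp X)" by (rule restrict_in_Cp[OF continuous_map_real_mult_left[OF f]])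
    then have hc: "continuous_map X euclideanreal ?h" unfolding topspace_Cp by blast
    have "?h \<in> (\<Pi>\<^sub>E i\<in>?E. Q i)"
    proof (rule PiE_I)
      fix i assume i: "i \<in> ?E"
      have "0 \<in> Q i" using Q(1) i by (auto simp: PiE_iff)
      then show "?h i \<in> Q i" using f0 i by (cases "Q i = UNIV") auto
    qed simp
    then have "?h \<in> W" by (rule subsetD[OF Q(3)])
    then have "?h \<in> {f \<in> topspace (Cp X). T f y \<in> {-1<..<1}}"
      unfolding W(2) using hc by (intro IntI CollectI)
    then have "T ?h y \<in> {-1<..<1}" by simp
    moreover have "T ?h y = 1" using scale[OF f, of c] nz unfolding c_def by simp
    ultimately show False by simp
  qed
  then show ?thesis using Q(2) by (intro exI[of _ ?F]) simp
qed

theorem theorem1p4: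
  fixes X :: "'a topology" and Y :: "'b topology"
    and T :: "('a \<Rightarrow> real) \<Rightarrow> ('b \<Rightarrow> real)"
  assumes "Tychonoff_space X" and "topspace X \<noteq> {}"
    and "Tychonoff_space Y" and "topspace Y \<noteq> {}"
    and "Cp_linear X Y T"
    and "continuous_map (Cp X) (Cp Y) T"
    and "T ` topspace (Cp X) = topspace (Cp Y)"
    and "covering_dim X = 0"
  shows "covering_dim Y = 0"
proof -
  let ?E = "topspace X"
  define L where "L y f = T (restrict f ?E) y" for y f
  have TCp: "T (restrict f ?E) \<in> topspace (Cp Y)" if "continuous_map X euclideanreal f" for f
    using assms(7) restrict_in_Cp[OF that] by blast
  have scale: "L y (\<lambda>x. c * f x) = c * L y f"
    if "y \<in> topspace Y" "continuous_map X euclideanreal f" for y c f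
  proof -
    have "restrict (\<lambda>x. c * f x) ?E = (\<lambda>x\<in>?E. c * restrict f ?E x)" by auto
    moreover have "T (\<lambda>x\<in>?E. c * restrict f ?E x) = (\<lambda>y\<in>topspace Y. c * T (restrict f ?E) y)"
      using assms(5) restrict_in_Cp[OF that(2)] unfolding Cp_linear_def by blast
    ultimately show ?thesis using that(1) unfolding L_def by simp
  qed
  interpret finitely_supported_surjection X Y L
  proof
    show "\<exists>U. continuous_map X euclideanreal (indicator U) \<and>
          (\<forall>x\<in>?E. (f x \<le> a \<longrightarrow> x \<in> U) \<and> (x \<in> U \<longrightarrow> f x < b))"
      if "continuous_map X euclideanreal f" "a < b" for f a b
      using covering_dim_0_imp_clopen_separation assms(8) that covering_dim_eq_0_iff by blast
    show "L y (\<lambda>x. f x + h x) = L y f + L y h"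
      if "y \<in> topspace Y" "continuous_map X euclideanreal f" "continuous_map X euclideanreal h" for y f h
    proof -
      have "restrict (\<lambda>x. f x + h x) ?E = (\<lambda>x\<in>?E. restrict f ?E x + restrict h ?E x)" by auto
      moreover have "T (\<lambda>x\<in>?E. restrict f ?E x + restrict h ?E x)
          = (\<lambda>y\<in>topspace Y. T (restrict f ?E) y + T (restrict h ?E) y)"
        using assms(5) restrict_in_Cp[OF that(2)] restrict_in_Cp[OF that(3)] unfolding Cp_linear_def by blast
      ultimately show ?thesis using that(1) unfolding L_def by simp
    qed
    show "L y (\<lambda>x. c * f x) = c * L y f"
      if "y \<in> topspace Y" "continuous_map X euclideanreal f" for y c f
      using scale that .
    show "\<exists>F. finite F \<and> F \<subseteq> ?E \<and>
          (\<forall>f. continuous_map X euclideanreal f \<longrightarrow> (\<forall>x\<in>F. f x = 0) \<longrightarrow> L y f = 0)"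
      if "y \<in> topspace Y" for y
      unfolding L_def
      by (rule continuous_functional_finite_support[OF assms(6) that scale[OF that, unfolded L_def]])
    show "continuous_map Y euclideanreal (\<lambda>y. L y f)" if "continuous_map X euclideanreal f" for f
      using TCp[OF that] unfolding L_def topspace_Cp by simp
    show "\<exists>f. continuous_map X euclideanreal f \<and> (\<forall>y\<in>topspace Y. L y f = g y)"
      if g: "continuous_map Y euclideanreal g" for g
    proof -
      obtain f where f: "f \<in> topspace (Cp X)" "T f = restrict g (topspace Y)"
        using restrict_in_Cp[OF g] assms(7) by (metis imageE)
      then have "restrict f ?E = f" "continuous_map X euclideanreal f"
        unfolding topspace_Cp by (auto simp: extensional_restrict)
      then show ?thesis using f(2) unfolding L_def by (intro exI[of _ f]) simp
    qed
  qed
  show ?thesis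
    unfolding covering_dim_eq_0_iff by (rule clopen_separation_imp_covering_dim_0) (rule codomain_zero_dim)
qed

end
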